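(* Let $\mathcal N_{X_1X_2\to B_2B_3}:(x_1,x_2)\mapsto\rho_{B_2B_3}^{(x_1x_2)}$ be a classical-quantum relay channel, let $p_{X_1X_2}$ be a probability distribution on $\mathcal X_1\times\mathcal X_2$, and let $$\rho_{X_1X_2B_2B_3}=\sum_{x_1,x_2}p_{X_1X_2}(x_1,x_2)|x_1x_2\rangle\langle x_1x_2|_{X_1X_2}\otimes\rho_{B_2B_3}^{(x_1x_2)} .$$ Given $R\in\mathbb R_{\ge0}$, $\varepsilon\in(0,1)$ and $b\in\mathbb N$, set $$\delta=b\Big[f(1,\varepsilon)+f(2,\varepsilon)+4\cdot2^{R-D_H^\varepsilon\left(\rho_{X_2B_3}\Vert\rho_{X_2B_3}^{(\{X_2,B_3\})}\right)}+4\cdot2^{R-D_H^\varepsilon\left(\rho_{X_1X_2B_2}\Vert\rho_{X_1X_2B_2}^{(\{X_1,B_2\})}\right)}\Big].$$ If $\delta\in[0,1]$, then the triple $\left(\frac{b-1}{b}R,\,b,\,\delta\right)$ is achievable for $\mathcal N$.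
   Context: All alphabets are finite, all Hilbert spaces finite-dimensional, and $\log$ is base 2. Universal function: $f(k,\varepsilon)=\big(1+6\cdot2^{\frac{k+1}{2}}+4\cdot2^{2^{k+5}+k^2+2k}\big)\varepsilon^{1/3}$. Hypothesis-testing relative entropy: $D_H^\varepsilon(\rho\Vert\sigma)=\max_{0\le\Pi\le I,\ \mathrm{tr}(\Pi\rho)\ge1-\varepsilon}-\log\mathrm{tr}(\Pi\sigma)$ (with $-\log0=+\infty$). Conditional product states: for a classical-quantum state $\rho_{XB}=\sum_xp_X(x)|x\rangle\langle x|_X\otimes\rho_B^{(x)}$ with $X=(X_v)_{v\in V}$ and $S\subseteq V$, $\overline S=V\setminus S$, define $\rho_{XB}^{(\{X_S,B\})}=\sum_xp_X(x)|x\rangle\langle x|_X\otimes\rho_B^{(x_{\overline S})}$, where $\rho_B^{(x_{\overline S})}=\sum_{x_S}p_{X_S|X_{\overline S}}(x_S|x_{\overline S})\rho_B^{(x_S,x_{\overline S})}$. In particular $\rho_{X_2B_3}^{(\{X_2,B_3\})}=\rho_{X_2}\otimes\rho_{B_3}$. States with fewer subscripts are reduced states (partial traces). Classical-quantum relay channel: a map $\mathcal N_{X_1X_2\to B_2B_3}$ assigning to each $(x_1,x_2)\in\mathcal X_1\times\mathcal X_2$ a quantum state $\rho_{B_2B_3}^{(x_1x_2)}$ on $\mathcal H_{B_2}\otimes\mathcal H_{B_3}$. The sender inputs $x_1$, the relay inputs $x_2$ and obtains $B_2$, the receiver obtains $B_3$. Code: an $(n,2^{nR})$ code consists of (1) a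 message set $M$ with $|M|=2^{nR}$; (2) an encoding $x_1^n(m)\in\mathcal X_1^n$ for each $m\in M$; (3) relay operations (quantum channels) $\mathcal R_{(B_2)_{j-1}(B_2')_{j-1}\to(X_2)_j(B_2')_j}$, $j\in[n]$, where $(B_2)_j\cong B_2$, $(X_2)_j\cong X_2$ is classical, $(B_2')_j$ is an arbitrary quantum system, and $(B_2)_0(B_2')_0$ is trivial (dimension 1); (4) a receiver POVM $\{Q_{B_3^n}^{(m)}\}_{m\in M}$. In round $j$ the sender transmits $(x_1)_j(m)$, while the relay applies its $j$-th operation to $(B_2)_{j-1}(B_2')_{j-1}$, transmits $(X_2)_j$ and keeps $(B_2')_j$; the channel outputs $(B_2)_j$ to the relay and $(B_3)_j$ to the receiver. With $\rho_{B_3^n}(m)$ the receiver's final state, the average error probability is $p_e=\frac1{|M|}\sum_{m}\mathrm{tr}[(I-Q_{B_3^n}^{(m)})\rho_{B_3^n}(m)]$. Achievability: for $R\ge0$, $n\in\mathbb N$, $\delta\in[0,1]$, the triple $(R,n,\delta)$ is achievable if there is an $(n,2^{nR'})$ code with $R'\ge R$ and $p_e\le\delta$. *)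

theory Defs
  imports "HOL-Probability.Probability"
begin

text \<open>
  A Hilbert space is \<open>\<complex>\<^sup>I\<close> for a finite set \<open>I\<close> of basis labels, so that tensor products are
  formed by pairing labels, the \<open>n\<close>-fold tensor power is labelled by the lists of length \<open>n\<close>, and
  the dimension may be quantified over inside a formula. An operator is given by its matrix
  entries, which are extended by \<open>0\<close> outside \<open>I \<times> I\<close>; this makes equality of operators on
  \<open>\<complex>\<^sup>I\<close> plain equality of functions.
\<close>

type_synonym 'i oper = "'i \<Rightarrow> 'i \<Rightarrow> complex"

definition operators :: "'i set \<Rightarrow> 'i oper set" where
  "operators I = {A. \<forall>i j. A i j \<noteq> 0 \<longrightarrow> i \<in> I \<and> j \<in> I}"

definition id_op :: "'i set \<Rightarrow> 'i oper" where
  "id_op I = (\<lambda>i j. if i = j \<and> i \<in> I then 1 else 0)"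

definition op_diff :: "'i oper \<Rightarrow> 'i oper \<Rightarrow> 'i oper" where
  "op_diff A B = (\<lambda>i j. A i j - B i j)"

definition op_mult :: "'i set \<Rightarrow> 'i oper \<Rightarrow> 'i oper \<Rightarrow> 'i oper" where
  "op_mult I A B = (\<lambda>i j. \<Sum>k\<in>I. A i k * B k j)"

definition op_trace :: "'i set \<Rightarrow> 'i oper \<Rightarrow> complex" where
  "op_trace I A = (\<Sum>i\<in>I. A i i)"

definition psd :: "'i set \<Rightarrow> 'i oper \<Rightarrow> bool" where
  "psd I A \<longleftrightarrow> A \<in> operators I \<and>
     (\<forall>v :: 'i \<Rightarrow> complex. (\<Sum>i\<in>I. \<Sum>j\<in>I. cnj (v i) * A i j * v j) \<in> \<real>\<^sub>\<ge>\<^sub>0)"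

definition state :: "'i set \<Rightarrow> 'i oper \<Rightarrow> bool" where
  "state I \<rho> \<longleftrightarrow> finite I \<and> psd I \<rho> \<and> op_trace I \<rho> = 1"

definition ketbra :: "'x \<Rightarrow> 'x oper" where
  "ketbra x = (\<lambda>i j. if i = x \<and> j = x then 1 else 0)"

definition tensor :: "'i oper \<Rightarrow> 'k oper \<Rightarrow> ('i \<times> 'k) oper" where
  "tensor A B = (\<lambda>(i, k) (j, l). A i j * B k l)"

definition povm :: "'i set \<Rightarrow> 'm set \<Rightarrow> ('m \<Rightarrow> 'i oper) \<Rightarrow> bool" where
  "povm I M Q \<longleftrightarrow> (\<forall>m\<in>M. psd I (Q m)) \<and> (\<lambda>i j. \<Sum>m\<in>M. Q m i j) = id_op I"

text \<open>The map \<open>\<Phi> \<otimes> id\<close>: apply \<open>\<Phi>\<close> to each block of \<open>A\<close> with fixed labels in the second factor.\<close>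

definition map_tensor_id :: "('i oper \<Rightarrow> 'j oper) \<Rightarrow> ('i \<times> 'k) oper \<Rightarrow> ('j \<times> 'k) oper" where
  "map_tensor_id \<Phi> A = (\<lambda>(i, k) (j, l). \<Phi> (\<lambda>s t. A (s, k) (t, l)) i j)"

definition quantum_channel :: "'i set \<Rightarrow> 'j set \<Rightarrow> ('i oper \<Rightarrow> 'j oper) \<Rightarrow> bool" where
  "quantum_channel I J \<Phi> \<longleftrightarrow>
     finite I \<and> finite J \<and>
     (\<forall>A\<in>operators I. \<Phi> A \<in> operators J) \<and>
     (\<forall>A\<in>operators I. \<forall>B\<in>operators I. \<forall>c.
        \<Phi> (\<lambda>i j. c * A i j + B i j) = (\<lambda>i j. c * \<Phi> A i j + \<Phi> B i j)) \<and>
     (\<forall>d::nat. \<forall>A. psd (I \<times> {..<d}) A \<longrightarrow> psd (J \<times> {..<d}) (map_tensor_id \<Phi> A)) \<and>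
     (\<forall>A\<in>operators I. op_trace J (\<Phi> A) = op_trace I A)"

definition neg_log2 :: "real \<Rightarrow> ereal" where
  "neg_log2 t = (if t = 0 then \<infinity> else ereal (- log 2 t))"

text \<open>
  The supremum over the tests is attained. Traces of products of positive operators are real, so
  \<^const>\<open>Re\<close> only changes the type.
\<close>

definition hyp_test_entropy :: "real \<Rightarrow> 'i::finite oper \<Rightarrow> 'i oper \<Rightarrow> ereal" where
  "hyp_test_entropy \<epsilon> \<rho> \<sigma> =
     (SUP P \<in> {P. psd UNIV P \<and> psd UNIV (op_diff (id_op UNIV) P) \<and>
                  Re (op_trace UNIV (op_mult UNIV P \<rho>)) \<ge> 1 - \<epsilon>}.
        neg_log2 (Re (op_trace UNIV (op_mult UNIV P \<sigma>))))"

text \<open>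
  \<open>2\<^sup>x\<close> for \<open>x < \<infinity>\<close>, with \<open>2\<^sup>-\<^sup>\<infinity> = 0\<close>. The relative entropy of two states is never \<open>-\<infinity>\<close>
  (the test \<open>P = I\<close> is always admissible when \<open>\<epsilon> \<ge> 0\<close>), so the value at \<open>\<infinity>\<close> plays no role.
\<close>

definition pow2 :: "ereal \<Rightarrow> real" where
  "pow2 x = (case x of ereal r \<Rightarrow> 2 powr r | PInfty \<Rightarrow> undefined | MInfty \<Rightarrow> 0)"

definition univ_f :: "nat \<Rightarrow> real \<Rightarrow> real" where
  "univ_f k \<epsilon> =
     (1 + 6 * 2 powr ((real k + 1) / 2) + 4 * 2 ^ (2 ^ (k + 5) + k\<^sup>2 + 2 * k)) * \<epsilon> powr (1 / 3)"

definition cq_state :: "('x::finite \<Rightarrow> real) \<Rightarrow> ('x \<Rightarrow> 'b oper) \<Rightarrow> ('x \<times> 'b) oper" where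
  "cq_state p \<rho> = (\<lambda>u v. \<Sum>x\<in>UNIV. of_real (p x) * tensor (ketbra x) (\<rho> x) u v)"

text \<open>
  The distribution \<open>p\<^sub>X\<close> and the conditional states \<open>\<rho>\<^sub>B\<^sup>(\<^sup>x\<^sup>)\<close> of a classical-quantum state
  \<open>\<rho>\<^sub>X\<^sub>B\<close>. If \<open>p\<^sub>X(x) = 0\<close>, the conditional state is not determined by \<open>\<rho>\<^sub>X\<^sub>B\<close>; the value given
  here is \<open>0\<close>, and it always enters with weight \<open>0\<close> below.
\<close>

definition cq_prob :: "('x \<times> 'b::finite) oper \<Rightarrow> 'x \<Rightarrow> real" where
  "cq_prob \<rho> x = Re (\<Sum>b\<in>UNIV. \<rho> (x, b) (x, b))"

definition cq_cond :: "('x \<times> 'b::finite) oper \<Rightarrow> 'x \<Rightarrow> 'b oper" where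
  "cq_cond \<rho> x = (\<lambda>b b'. \<rho> (x, b) (x, b') / of_real (cq_prob \<rho> x))"

text \<open>
  The state \<open>\<rho>\<^sub>X\<^sub>B\<close> with superscript \<open>({X\<^sub>S, B})\<close>. The subset \<open>S\<close> of the components of
  \<open>x = (x\<^sub>v)\<^sub>v\<close> is given by the map \<open>r\<close> that sends \<open>x\<close> to its components outside \<open>S\<close>: it is
  \<^const>\<open>snd\<close> for \<open>S = {1}\<close> and \<open>X = (X\<^sub>1, X\<^sub>2)\<close>, and constant if \<open>S\<close> contains all components.
  The quotient is \<open>p(x\<^sub>S|x)\<close> conditioned on the components outside \<open>S\<close>.
\<close>

definition cond_product_state ::
  "('x::finite \<Rightarrow> 'y) \<Rightarrow> ('x \<times> 'b::finite) oper \<Rightarrow> ('x \<times> 'b) oper" where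
  "cond_product_state r \<rho> =
     cq_state (cq_prob \<rho>)
       (\<lambda>x b b'. \<Sum>x' | r x' = r x.
          of_real (cq_prob \<rho> x' / (\<Sum>x'' | r x'' = r x. cq_prob \<rho> x'')) * cq_cond \<rho> x' b b')"

lemma cq_state_apply:
  "cq_state p \<rho> (x, b) (x', b') = (if x = x' then of_real (p x) * \<rho> x b b' else 0)"
proof -
  have "cq_state p \<rho> (x, b) (x', b') =
      (\<Sum>z\<in>UNIV. if z = x then (if x = x' then of_real (p x) * \<rho> x b b' else 0) else 0)"
    unfolding cq_state_def tensor_def ketbra_def by (intro sum.cong) auto
  then show ?thesis by simp
qed

lemma cq_prob_cq_state:
  assumes "\<And>x. state UNIV (\<rho> x)"
  shows "cq_prob (cq_state p \<rho>) x = p x"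
proof -
  have "(\<Sum>b\<in>UNIV. \<rho> x b b) = 1"
    using assms[of x] by (simp add: state_def op_trace_def)
  then show ?thesis
    by (simp add: cq_prob_def cq_state_apply flip: sum_distrib_left)
qed

lemma cond_product_state_cq_state:
  fixes \<rho> :: "'x::finite \<Rightarrow> 'b::finite oper"
  assumes "\<And>x. state UNIV (\<rho> x)"
  shows "cond_product_state r (cq_state p \<rho>) =
     cq_state p (\<lambda>x b b'. \<Sum>x' | r x' = r x.
        of_real (p x' / (\<Sum>x'' | r x'' = r x. p x'')) * \<rho> x' b b')"
proof -
  have *: "of_real (p x' / s) * cq_cond (cq_state p \<rho>) x' b b' = of_real (p x' / s) * \<rho> x' b b'"
    for x' s b b'
    by (simp add: cq_cond_def cq_prob_cq_state[OF assms] cq_state_apply)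
  show ?thesis
    unfolding cond_product_state_def cq_prob_cq_state[OF assms] *
    by (rule arg_cong2[of _ _ _ _ cq_state]) auto
qed

lemma cond_product_state_all:
  fixes \<rho> :: "'x::finite \<Rightarrow> 'b::finite oper"
  assumes "\<And>x. state UNIV (\<rho> x)" and "(\<Sum>x\<in>UNIV. p x) = 1"
  shows "cond_product_state (\<lambda>_. ()) (cq_state p \<rho>) =
     tensor (\<lambda>x x'. \<Sum>b\<in>UNIV. cq_state p \<rho> (x, b) (x', b))
            (\<lambda>b b'. \<Sum>x\<in>UNIV. cq_state p \<rho> (x, b) (x, b'))"
proof -
  have tr: "(\<Sum>b\<in>UNIV. \<rho> x b b) = 1" for x
    using assms(1)[of x] by (simp add: state_def op_trace_def)
  have m: "(\<Sum>b\<in>UNIV. if x = x' then of_real (p x) * \<rho> x b b else 0) =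
      (if x = x' then of_real (p x) else 0)" for x x'
    by (simp add: tr flip: sum_distrib_left)
  show ?thesis
    unfolding cond_product_state_cq_state[OF assms(1)]
    by (auto simp: fun_eq_iff cq_state_apply tensor_def assms(2) m)
qed

definition cq_relay_channel :: "('x1::finite \<times> 'x2::finite \<Rightarrow> ('b2::finite \<times> 'b3::finite) oper) \<Rightarrow> bool" where
  "cq_relay_channel N \<longleftrightarrow> (\<forall>x. state UNIV (N x))"

definition reduce_X2B3 ::
  "(('x1::finite \<times> 'x2) \<times> ('b2::finite \<times> 'b3)) oper \<Rightarrow> ('x2 \<times> 'b3) oper" where
  "reduce_X2B3 \<rho> = (\<lambda>(x2, b3) (x2', b3').
     \<Sum>x1\<in>UNIV. \<Sum>b2\<in>UNIV. \<rho> ((x1, x2), (b2, b3)) ((x1, x2'), (b2, b3')))"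

definition reduce_X1X2B2 ::
  "(('x1 \<times> 'x2) \<times> ('b2 \<times> 'b3::finite)) oper \<Rightarrow> (('x1 \<times> 'x2) \<times> 'b2) oper" where
  "reduce_X1X2B2 \<rho> = (\<lambda>(x, b2) (x', b2').
     \<Sum>b3\<in>UNIV. \<rho> (x, (b2, b3)) (x', (b2', b3)))"

text \<open>
  Codewords are lists, so \<open>(x\<^sub>1)\<^sub>j(m)\<close> is \<open>enc m ! (j - 1)\<close>. The memory \<open>(B\<^sub>2')\<^sub>j\<close> has the basis
  labels \<open>{..<mem_dim j}\<close>. The relay operation number \<open>j \<ge> 1\<close> is \<open>relay_op j\<close>.
\<close>

record ('x1, 'x2, 'b2, 'b3) relay_code =
  messages :: "nat set"
  enc :: "nat \<Rightarrow> 'x1 list"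
  mem_dim :: "nat \<Rightarrow> nat"
  relay_op :: "nat \<Rightarrow> ('b2 option \<times> nat) oper \<Rightarrow> ('x2 \<times> nat) oper"
  decoder :: "nat \<Rightarrow> 'b3 list oper"

text \<open>
  Basis labels of \<open>(B\<^sub>2)\<^sub>j (B\<^sub>2')\<^sub>j\<close>. The label \<^const>\<open>None\<close> spans the trivial system \<open>(B\<^sub>2)\<^sub>0\<close>,
  and the labels \<open>Some b\<close> span a copy of \<open>B\<^sub>2\<close> for \<open>j \<ge> 1\<close>.
\<close>

definition relay_labels :: "('x1, 'x2, 'b2, 'b3) relay_code \<Rightarrow> nat \<Rightarrow> ('b2 option \<times> nat) set" where
  "relay_labels C j = (if j = 0 then {None} else range Some) \<times> {..<mem_dim C j}"

definition valid_code ::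
  "nat \<Rightarrow> real \<Rightarrow> ('x1::finite, 'x2::finite, 'b2::finite, 'b3::finite) relay_code \<Rightarrow> bool" where
  "valid_code n R C \<longleftrightarrow>
     finite (messages C) \<and> real (card (messages C)) = 2 powr (real n * R) \<and>
     (\<forall>m\<in>messages C. length (enc C m) = n) \<and>
     mem_dim C 0 = 1 \<and>
     (\<forall>j\<in>{1..n}.
        quantum_channel (relay_labels C (j - 1)) (UNIV \<times> {..<mem_dim C j}) (relay_op C j) \<and>
        (\<forall>A\<in>operators (relay_labels C (j - 1)). \<forall>x x' k k'.
           x \<noteq> x' \<longrightarrow> relay_op C j A (x, k) (x', k') = 0)) \<and>
     povm {bs. length bs = n} (messages C) (decoder C)"

text \<open>
  One use of the channel with sender input \<open>x\<^sub>1\<close>: the classical register \<open>X\<^sub>2\<close> is replaced by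
  \<open>B\<^sub>2 B\<^sub>3\<close>, leaving the relay memory (labels \<open>k\<close>) and the earlier outputs at the receiver untouched;
  the new \<open>B\<^sub>3\<close> is appended to the latter.
\<close>

definition channel_use ::
  "('x1 \<times> 'x2::finite \<Rightarrow> ('b2 \<times> 'b3) oper) \<Rightarrow> 'x1 \<Rightarrow>
   (('x2 \<times> nat) \<times> 'b3 list) oper \<Rightarrow> (('b2 option \<times> nat) \<times> 'b3 list) oper" where
  "channel_use N x1 \<sigma> = (\<lambda>((c, k), bs) ((c', k'), bs').
     if c = None \<or> c' = None \<or> bs = [] \<or> bs' = [] then 0
     else \<Sum>x2\<in>UNIV. \<sigma> ((x2, k), butlast bs) ((x2, k'), butlast bs') *
            N (x1, x2) (the c, last bs) (the c', last bs'))"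

primrec joint_state ::
  "('x1 \<times> 'x2::finite \<Rightarrow> ('b2 \<times> 'b3) oper) \<Rightarrow> ('x1, 'x2, 'b2, 'b3) relay_code \<Rightarrow> nat \<Rightarrow> nat \<Rightarrow>
   (('b2 option \<times> nat) \<times> 'b3 list) oper" where
  "joint_state N C m 0 = ketbra ((None, 0), [])"
| "joint_state N C m (Suc j) =
     channel_use N (enc C m ! j) (map_tensor_id (relay_op C (Suc j)) (joint_state N C m j))"

definition receiver_state ::
  "('x1 \<times> 'x2::finite \<Rightarrow> ('b2 \<times> 'b3) oper) \<Rightarrow> ('x1, 'x2, 'b2, 'b3) relay_code \<Rightarrow> nat \<Rightarrow> nat \<Rightarrow>
   'b3 list oper" where
  "receiver_state N C n m =
     (\<lambda>bs bs'. \<Sum>u\<in>relay_labels C n. joint_state N C m n (u, bs) (u, bs'))"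

definition error_prob ::
  "('x1 \<times> 'x2::finite \<Rightarrow> ('b2 \<times> 'b3) oper) \<Rightarrow> nat \<Rightarrow> ('x1, 'x2, 'b2, 'b3) relay_code \<Rightarrow> real" where
  "error_prob N n C =
     (\<Sum>m\<in>messages C.
        Re (op_trace {bs. length bs = n}
              (op_mult {bs. length bs = n}
                 (op_diff (id_op {bs. length bs = n}) (decoder C m)) (receiver_state N C n m))))
     / real (card (messages C))"

definition achievable ::
  "('x1::finite \<times> 'x2::finite \<Rightarrow> ('b2::finite \<times> 'b3::finite) oper) \<Rightarrow> real \<Rightarrow> nat \<Rightarrow> real \<Rightarrow> bool" where
  "achievable N R n \<delta> \<longleftrightarrow>
     (\<exists>R' \<ge> R. \<exists>C. valid_code n R' C \<and> error_prob N n C \<le> \<delta>)"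

end

theory Submission
  imports Defs
begin

text \<open>
  The code is multi-hop decode-and-forward with one channel use per block: in block \<open>j\<close> the
  sender encodes the messages \<open>(m\<^sub>j\<^sub>-\<^sub>1, m\<^sub>j)\<close>, the relay transmits its estimate of \<open>m\<^sub>j\<^sub>-\<^sub>1\<close> and
  decodes \<open>m\<^sub>j\<close> from \<open>B\<^sub>2\<close>, and the receiver decodes \<open>m\<^sub>j\<^sub>-\<^sub>1\<close> from \<open>B\<^sub>3\<close>. Between the blocks the
  relay keeps only its classical estimate, so the error of the code is at most the sum of the
  errors of the blocks, averaged over the pair of messages, and one codebook serves all blocks.
  The boundary messages \<open>m\<^sub>0\<close> and \<open>m\<^sub>b\<close> carry no information and are fixed by averaging.

  Both decoders apply the nearly optimal hypothesis tests of the candidates one after the other.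
  By Gao's quantum union bound their errors are at most \<open>4 tr (1 - P\<^sub>m)\<sigma> + 4 \<Sum>\<^sub>l\<^sub>\<noteq>\<^sub>m tr P\<^sub>l \<sigma>\<close>; the average
  over a random superposition code turns the first term into \<open>4\<epsilon>\<close> and the second one into
  \<open>4 (K - 1) 2\<^sup>-\<^sup>D\<close>, where \<open>K = \<lceil>2\<^sup>R\<rceil>\<close> is the number of messages of a block. No simultaneous
  decoding is required, so the summands \<open>f(1, \<epsilon>)\<close> and \<open>f(2, \<epsilon>)\<close> are only used as a bound for
  multiples of \<open>\<epsilon>\<close>, which also absorb the loss from tests that do not attain the supremum.
\<close>

subsection \<open>Positive operators\<close>

definition qform :: "'i set \<Rightarrow> 'i oper \<Rightarrow> ('i \<Rightarrow> complex) \<Rightarrow> complex" where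
  "qform I A v = (\<Sum>i\<in>I. \<Sum>j\<in>I. cnj (v i) * A i j * v j)"

lemma psd_iff_qform: "psd I A \<longleftrightarrow> A \<in> operators I \<and> (\<forall>v. qform I A v \<in> \<real>\<^sub>\<ge>\<^sub>0)"
  by (simp add: psd_def qform_def)

text \<open>Vectors supported on two labels probe one pair of off-diagonal entries. They give
  Hermiticity and the vanishing of a row whose diagonal entry is zero.\<close>

lemma qform_two_points:
  assumes "finite I" "i \<in> I" "j \<in> I" "i \<noteq> j"
  shows "qform I A (\<lambda>k. if k = i then x else if k = j then y else 0) =
    cnj x * A i i * x + cnj x * A i j * y + cnj y * A j i * x + cnj y * A j j * y"
proof -
  let ?v = "\<lambda>k. if k = i then x else if k = j then y else 0"
  have s: "(\<Sum>k\<in>I. g k * ?v k) = g i * x + g j * y" for g :: "_ \<Rightarrow> complex"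
  proof -
    have "(\<Sum>k\<in>I. g k * ?v k) = (\<Sum>k\<in>I. (if k = i then g i * x else 0) + (if k = j then g j * y else 0))"
      using assms(4) by (intro sum.cong) auto
    then show ?thesis using assms by (simp add: sum.distrib)
  qed
  have s': "(\<Sum>k\<in>I. cnj (?v k) * g k) = cnj x * g i + cnj y * g j" for g :: "_ \<Rightarrow> complex"
  proof -
    have "(\<Sum>k\<in>I. cnj (?v k) * g k) = (\<Sum>k\<in>I. (if k = i then cnj x * g i else 0) + (if k = j then cnj y * g j else 0))"
      using assms(4) by (intro sum.cong) auto
    then show ?thesis using assms by (simp add: sum.distrib)
  qed
  have "qform I A ?v = (\<Sum>i\<in>I. cnj (?v i) * (\<Sum>j\<in>I. A i j * ?v j))"
    by (simp add: qform_def sum_distrib_left mult.assoc)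
  also have "\<dots> = cnj x * (A i i * x + A i j * y) + cnj y * (A j i * x + A j j * y)"
    unfolding s s' ..
  finally show ?thesis by (simp add: algebra_simps)
qed

lemma qform_point:
  assumes "finite I" "i \<in> I"
  shows "qform I A (\<lambda>k. if k = i then x else 0) = cnj x * A i i * x"
proof -
  have "qform I A (\<lambda>k. if k = i then x else 0) =
     (\<Sum>k\<in>I. if k = i then \<Sum>l\<in>I. if l = i then cnj x * A i i * x else 0 else 0)"
    unfolding qform_def by (intro sum.cong) (auto intro!: sum.cong sum.neutral)
  then show ?thesis using assms by simp
qed

lemma psd_diag:
  assumes "finite I" "psd I A"
  shows "A i i \<in> \<real>\<^sub>\<ge>\<^sub>0"
proof (cases "i \<in> I")
  case True
  then show ?thesis
    using assms qform_point[OF assms(1) True, of A 1] by (simp add: psd_iff_qform) metis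
next
  case False
  then have "A i i = 0" using assms by (auto simp: psd_def operators_def)
  then show ?thesis by simp
qed

text \<open>Polarisation: the form is real at the weights (1, 1) and (1, i), which kills the
  imaginary part of \<open>A i j + A j i\<close> and the real part of
  \<open>A i j - A j i\<close>.\<close>

lemma psd_hermitian:
  assumes "finite I" "psd I A"
  shows "A j i = cnj (A i j)"
proof (cases "i \<in> I \<and> j \<in> I \<and> i \<noteq> j")
  case True
  have d: "Im (A i i) = 0" "Im (A j j) = 0"
    using psd_diag[OF assms] by (auto simp: complex_nonneg_Reals_iff)
  have nn: "qform I A v \<in> \<real>\<^sub>\<ge>\<^sub>0" for v
    using assms by (simp add: psd_iff_qform)
  have "Im (A i j + A j i) = 0"
    using nn[of "\<lambda>k. if k = i then 1 else if k = j then 1 else 0"] qform_two_points[of I i j A 1 1]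
      True assms d by (auto simp: complex_nonneg_Reals_iff)
  moreover have "Re (A i j - A j i) = 0"
    using nn[of "\<lambda>k. if k = i then 1 else if k = j then \<i> else 0"] qform_two_points[of I i j A 1 \<i>]
      True assms d by (auto simp: complex_nonneg_Reals_iff)
  ultimately show ?thesis by (auto simp: complex_eq_iff)
next
  case False
  then consider "i \<notin> I \<or> j \<notin> I" | "i = j" by auto
  then show ?thesis
  proof cases
    case 1
    then have "A i j = 0" "A j i = 0"
      using assms(2) by (auto simp: psd_def operators_def)
    then show ?thesis by simp
  next
    case 2
    then show ?thesis
      using psd_diag[OF assms, of i] by (auto simp: complex_nonneg_Reals_iff complex_eq_iff)
  qed
qed

text \<open>Without the quadratic term, the form at the vector with \<open>t\<close> on
  \<open>a\<close> and 1 on \<open>i\<close> is affine in \<open>t\<close>, so a nonzero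
  \<open>A a i\<close> would make it unbounded below.\<close>

lemma psd_zero_diag:
  assumes "finite I" "psd I A" "A a a = 0"
  shows "A a i = 0"
proof (rule ccontr)
  assume nz: "A a i \<noteq> 0"
  then have ia: "a \<in> I" "i \<in> I" "a \<noteq> i"
    using assms by (auto simp: psd_def operators_def)
  \<comment> \<open>The factor is tuned so that the form takes the value -1.\<close>
  define s where "s = (Re (A i i) + 1) / (2 * (cmod (A a i))\<^sup>2)"
  define t where "t = - complex_of_real s * A a i"
  have h: "A i a = cnj (A a i)" using psd_hermitian[OF assms(1,2)] .
  have "qform I A (\<lambda>k. if k = a then t else if k = i then 1 else 0) \<in> \<real>\<^sub>\<ge>\<^sub>0"
    using assms(2) by (simp add: psd_iff_qform)
  then have "0 \<le> Re (cnj t * A a i + cnj (A a i) * t + A i i)"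
    using qform_two_points[OF assms(1) ia, of A t 1] assms(3)
    by (auto simp: complex_nonneg_Reals_iff h)
  also have "Re (cnj t * A a i + cnj (A a i) * t + A i i) = - 2 * s * (cmod (A a i))\<^sup>2 + Re (A i i)"
    unfolding t_def cmod_power2 by (simp add: algebra_simps power2_eq_square)
  also have "\<dots> = - 1" using nz by (simp add: s_def field_simps)
  finally show False by simp
qed

text \<open>Gaussian elimination: subtracting the rank-one operator built from a column of \<open>A\<close> clears
  that row and column and leaves a Schur complement, which is again positive.\<close>

lemma psd_rank_one_decomposition:
  assumes "finite I" "psd I A"
  shows "\<exists>(r::nat) u. \<forall>i j. A i j = (\<Sum>k<r. u k i * cnj (u k j))"
  using assms
proof (induction I arbitrary: A rule: finite_induct)
  case empty
  then show ?case by (intro exI[of _ 0]) (auto simp: psd_def operators_def)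
next
  case (insert a F)
  let ?I = "insert a F"
  have fin: "finite ?I" using insert by simp
  define \<alpha> where "\<alpha> = Re (A a a)"
  have \<alpha>: "A a a = of_real \<alpha>" "\<alpha> \<ge> 0"
    using psd_diag[OF fin insert.prems, of a] by (auto simp: complex_nonneg_Reals_iff \<alpha>_def complex_eq_iff)
  have herm: "A j i = cnj (A i j)" for i j using psd_hermitian[OF fin insert.prems] .
  have zero: "A a i = 0" if "\<alpha> = 0" for i
    using psd_zero_diag[OF fin insert.prems, of a i] \<alpha> that by simp
  \<comment> \<open>If \<open>\<alpha> = 0\<close>, division by zero makes the correction vanish;
    this is consistent because row and column \<open>a\<close> of \<open>A\<close> are then
    zero.\<close>
  define A' where "A' = (\<lambda>i j. A i j - A i a * A a j / of_real \<alpha>)"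
  have row: "A' a j = 0" "A' j a = 0" for j
    using zero[of j] herm[of j a] \<alpha>(1) by (cases "\<alpha> = 0"; simp add: A'_def)+
  have "A' \<in> operators F"
  proof -
    have "i \<in> ?I \<and> j \<in> ?I" if "A' i j \<noteq> 0" for i j
    proof -
      have "A i j \<noteq> 0 \<or> A i a \<noteq> 0 \<and> A a j \<noteq> 0" using that by (auto simp: A'_def)
      moreover have "\<forall>i j. A i j \<noteq> 0 \<longrightarrow> i \<in> ?I \<and> j \<in> ?I"
        using insert.prems by (auto simp: psd_def operators_def)
      ultimately show ?thesis by blast
    qed
    then show ?thesis using row unfolding operators_def by blast
  qed
  moreover have "qform F A' v \<in> \<real>\<^sub>\<ge>\<^sub>0" for v
  proof -
    define s where "s = (\<Sum>j\<in>F. A a j * v j)"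
    \<comment> \<open>This coordinate at \<open>a\<close> completes the square: row \<open>a\<close>
      of \<open>A\<close> annihilates \<open>w\<close>, and what remains is the form of the Schur
      complement at \<open>v\<close>.\<close>
    define w where "w = v(a := - s / of_real \<alpha>)"
    have w: "w j = v j" if "j \<in> F" for j using that insert.hyps by (auto simp: w_def)
    have cs: "cnj s = (\<Sum>i\<in>F. cnj (v i) * A i a)"
      unfolding s_def by (simp add: herm[of a] mult.commute)
    have inner: "(\<Sum>j\<in>?I. A i j * w j) = - (A i a * s / of_real \<alpha>) + (\<Sum>j\<in>F. A i j * v j)" for i
      using insert.hyps w by (simp add: w_def)
    have 0: "(\<Sum>j\<in>?I. A a j * w j) = 0"
      using \<alpha> zero by (cases "\<alpha> = 0") (auto simp: inner s_def)
    have "qform ?I A w = (\<Sum>i\<in>?I. cnj (w i) * (\<Sum>j\<in>?I. A i j * w j))"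
      by (simp add: qform_def sum_distrib_left mult.assoc)
    also have "\<dots> = (\<Sum>i\<in>F. cnj (w i) * (\<Sum>j\<in>?I. A i j * w j))"
      using insert.hyps 0 by simp
    also have "\<dots> = (\<Sum>i\<in>F. cnj (v i) * (- (A i a * s / of_real \<alpha>) + (\<Sum>j\<in>F. A i j * v j)))"
      by (intro sum.cong refl) (simp only: inner w)
    also have "\<dots> = (\<Sum>i\<in>F. cnj (v i) * (\<Sum>j\<in>F. A' i j * v j))"
    proof (intro sum.cong refl arg_cong2[of _ _ _ _ "(*)"])
      fix i
      show "- (A i a * s / of_real \<alpha>) + (\<Sum>j\<in>F. A i j * v j) = (\<Sum>j\<in>F. A' i j * v j)"
        unfolding A'_def s_def
        by (simp add: algebra_simps sum_subtractf sum_distrib_left sum_divide_distrib)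
    qed
    also have "\<dots> = qform F A' v"
      by (simp add: qform_def sum_distrib_left mult.assoc)
    finally show ?thesis using insert.prems by (metis psd_iff_qform)
  qed
  ultimately have "psd F A'" by (simp add: psd_iff_qform)
  from insert.IH[OF this] obtain r u where u: "A' i j = (\<Sum>k<(r::nat). u k i * cnj (u k j))" for i j
    by blast
  \<comment> \<open>The new rank-one term restores the part subtracted in \<open>A'\<close>; for
    \<open>\<alpha> = 0\<close> it is the zero vector, again by division by zero.\<close>
  define u' where "u' = u(r := \<lambda>i. A i a / of_real (sqrt \<alpha>))"
  have "A i j = (\<Sum>k<Suc r. u' k i * cnj (u' k j))" for i j
  proof -
    have "(\<Sum>k<Suc r. u' k i * cnj (u' k j)) = A' i j + A i a * A a j / of_real \<alpha>"
      using \<alpha>(2) by (simp add: u u'_def herm[of j a] flip: of_real_mult)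
    then show ?thesis by (simp add: A'_def)
  qed
  then show ?case by blast
qed

section \<open>Closure properties of the positive cone\<close>

lemma nonneg_Reals_sum:
  assumes "\<And>x. x \<in> X \<Longrightarrow> f x \<in> \<real>\<^sub>\<ge>\<^sub>0"
  shows "sum f X \<in> (\<real>\<^sub>\<ge>\<^sub>0 :: complex set)"
  using assms by (induction X rule: infinite_finite_induct) auto

lemma sum_pull2:
  "(\<Sum>i\<in>I. \<Sum>j\<in>J. \<Sum>q\<in>Q. h i j q) = (\<Sum>q\<in>Q. \<Sum>i\<in>I. \<Sum>j\<in>J. h i j q)"
proof -
  have "(\<Sum>i\<in>I. \<Sum>j\<in>J. \<Sum>q\<in>Q. h i j q) = (\<Sum>i\<in>I. \<Sum>q\<in>Q. \<Sum>j\<in>J. h i j q)"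
    by (intro sum.cong refl sum.swap)
  also have "\<dots> = (\<Sum>q\<in>Q. \<Sum>i\<in>I. \<Sum>j\<in>J. h i j q)" by (rule sum.swap)
  finally show ?thesis .
qed

lemma psd_sum:
  assumes "\<And>x. x \<in> X \<Longrightarrow> psd I (A x)"
  shows "psd I (\<lambda>i j. \<Sum>x\<in>X. A x i j)"
proof -
  have "(\<lambda>i j. \<Sum>x\<in>X. A x i j) \<in> operators I"
  proof -
    have "A x i j = 0" if "x \<in> X" "i \<notin> I \<or> j \<notin> I" for x i j
      using assms[OF that(1)] that(2) by (auto simp: psd_def operators_def)
    then have "(\<Sum>x\<in>X. A x i j) = 0" if "i \<notin> I \<or> j \<notin> I" for i j
      using that by (intro sum.neutral) blast
    then show ?thesis unfolding operators_def by blast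
  qed
  moreover have "qform I (\<lambda>i j. \<Sum>x\<in>X. A x i j) v = (\<Sum>x\<in>X. qform I (A x) v)" for v
    unfolding qform_def sum_distrib_left sum_distrib_right by (rule sum_pull2)
  ultimately show ?thesis
    using assms by (auto simp: psd_iff_qform intro!: nonneg_Reals_sum)
qed

lemma psd_scale:
  assumes "psd I A" "c \<ge> 0"
  shows "psd I (\<lambda>i j. of_real c * A i j)"
proof -
  have "qform I (\<lambda>i j. of_real c * A i j) v = of_real c * qform I A v" for v
    unfolding qform_def sum_distrib_left by (intro sum.cong refl) (simp add: algebra_simps)
  then show ?thesis
    using assms by (auto simp: psd_iff_qform operators_def intro!: nonneg_Reals_mult_I)
qed

lemma psd_rank_one:
  assumes "\<And>i. u i \<noteq> 0 \<Longrightarrow> i \<in> I"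
  shows "psd I (\<lambda>i j. u i * cnj (u j))"
proof -
  have "qform I (\<lambda>i j. u i * cnj (u j)) v = of_real ((cmod (\<Sum>j\<in>I. cnj (u j) * v j))\<^sup>2)" for v
    unfolding complex_norm_square qform_def cnj_sum sum_product
    by (subst sum.swap) (intro sum.cong refl, simp add: mult_ac)
  then show ?thesis using assms by (auto simp: psd_iff_qform operators_def)
qed

lemma psd_zero: "psd I (\<lambda>_ _. 0)"
  by (simp add: psd_def operators_def)

lemma psd_ketbra:
  assumes "k \<in> I"
  shows "psd I (ketbra k)"
proof -
  have "ketbra k = (\<lambda>i j. (if i = k then 1 else 0) * cnj (if j = k then 1 else 0))"
    by (auto simp: ketbra_def fun_eq_iff)
  moreover have "psd I (\<lambda>i j. (if i = k then 1 else 0) * cnj (if j = k then 1 else 0))"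
    using assms by (intro psd_rank_one) (auto split: if_splits)
  ultimately show ?thesis by (simp only:)
qed

lemma psd_id_op:
  assumes "finite I"
  shows "psd I (id_op I)"
proof -
  have "id_op I i j = (\<Sum>k\<in>I. ketbra k i j)" for i j
  proof -
    have "(\<Sum>k\<in>I. ketbra k i j) = (\<Sum>k\<in>I. if k = i then if i = j then 1 else 0 else 0)"
      by (intro sum.cong) (auto simp: ketbra_def)
    then show ?thesis using assms by (simp add: id_op_def)
  qed
  then have "id_op I = (\<lambda>i j. \<Sum>k\<in>I. ketbra k i j)" by blast
  moreover have "psd I (\<lambda>i j. \<Sum>k\<in>I. ketbra k i j)"
    by (intro psd_sum psd_ketbra)
  ultimately show ?thesis by (simp only:)
qed

lemma sum_rotate4:
  "(\<Sum>k\<in>K. \<Sum>l\<in>L. \<Sum>s\<in>S. \<Sum>t\<in>T. h k l s t) = (\<Sum>t\<in>T. \<Sum>k\<in>K. \<Sum>s\<in>S. \<Sum>l\<in>L. h k l s t)"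
proof -
  have "(\<Sum>k\<in>K. \<Sum>l\<in>L. \<Sum>s\<in>S. \<Sum>t\<in>T. h k l s t) = (\<Sum>k\<in>K. \<Sum>t\<in>T. \<Sum>l\<in>L. \<Sum>s\<in>S. h k l s t)"
    by (intro sum.cong refl sum_pull2)
  also have "\<dots> = (\<Sum>t\<in>T. \<Sum>k\<in>K. \<Sum>l\<in>L. \<Sum>s\<in>S. h k l s t)"
    by (rule sum.swap)
  also have "\<dots> = (\<Sum>t\<in>T. \<Sum>k\<in>K. \<Sum>s\<in>S. \<Sum>l\<in>L. h k l s t)"
    by (intro sum.cong refl sum.swap)
  finally show ?thesis .
qed

lemma qform_Times:
  "qform (I \<times> J) A v = (\<Sum>i\<in>I. \<Sum>k\<in>J. \<Sum>j\<in>I. \<Sum>l\<in>J. cnj (v (i, k)) * A (i, k) (j, l) * v (j, l))"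
  by (simp only: qform_def sum.cartesian_product')

text \<open>This is the partial trace against \<open>F\<close> on the first factor. Each rank-one
  term of \<open>F\<close> turns the form at \<open>v\<close> into the form of \<open>A\<close> at a
  product vector. Complete positivity of measurements and positivity of partial traces and of
  diagonal blocks all come from here.\<close>

lemma psd_contract:
  assumes "finite I" "psd I F" "psd (I \<times> J) A"
  shows "psd J (\<lambda>k l. \<Sum>s\<in>I. \<Sum>t\<in>I. F s t * A (t, k) (s, l))"
proof -
  obtain r u where u: "F s t = (\<Sum>q<(r::nat). u q s * cnj (u q t))" for s t
    using psd_rank_one_decomposition[OF assms(1,2)] by blast
  have "psd J (\<lambda>k l. \<Sum>s\<in>I. \<Sum>t\<in>I. w s * cnj (w t) * A (t, k) (s, l))" (is "psd J ?B") for w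
  proof -
    have "?B \<in> operators J"
    proof -
      have "A (t, k) (s, l) = 0" if "k \<notin> J \<or> l \<notin> J" for t k s l
        using assms(3) that by (auto simp: psd_def operators_def)
      then have "?B k l = 0" if "k \<notin> J \<or> l \<notin> J" for k l
        using that by simp
      then show ?thesis unfolding operators_def by blast
    qed
    moreover have "qform J ?B v = qform (I \<times> J) A (\<lambda>(t, k). w t * v k)" for v
      unfolding qform_def[of J] qform_Times sum_distrib_left sum_distrib_right
      by (subst sum_rotate4) (intro sum.cong refl, simp add: algebra_simps)
    ultimately show ?thesis using assms(3) by (simp add: psd_iff_qform)
  qed
  then have "psd J (\<lambda>k l. \<Sum>q<r. \<Sum>s\<in>I. \<Sum>t\<in>I. u q s * cnj (u q t) * A (t, k) (s, l))"
    by (rule psd_sum)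
  moreover have "(\<Sum>q<r. \<Sum>s\<in>I. \<Sum>t\<in>I. u q s * cnj (u q t) * A (t, k) (s, l)) =
      (\<Sum>s\<in>I. \<Sum>t\<in>I. F s t * A (t, k) (s, l))" for k l
    unfolding u sum_distrib_right by (rule sum_pull2[symmetric])
  ultimately show ?thesis by simp
qed

text \<open>Only \<open>A\<close> is split into rank-one terms; each of them contracts a vector on
  the product to a vector on \<open>J\<close>, where \<open>B\<close> is evaluated.\<close>

lemma psd_tensor:
  assumes "finite I" "psd I A" "psd J B"
  shows "psd (I \<times> J) (tensor A B)"
proof -
  obtain r u where u: "A i j = (\<Sum>q<(r::nat). u q i * cnj (u q j))" for i j
    using psd_rank_one_decomposition[OF assms(1,2)] by blast
  have "tensor A B \<in> operators (I \<times> J)"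
    using assms by (auto simp: psd_def operators_def tensor_def)
  moreover have "qform (I \<times> J) (tensor A B) v =
      (\<Sum>q<r. qform J B (\<lambda>k. \<Sum>i\<in>I. cnj (u q i) * v (i, k)))" for v
  proof -
    have 1: "qform J B (\<lambda>k. \<Sum>i\<in>I. cnj (w i) * v (i, k)) =
       (\<Sum>i\<in>I. \<Sum>k\<in>J. \<Sum>j\<in>I. \<Sum>l\<in>J. cnj (v (i, k)) * (w i * cnj (w j) * B k l) * v (j, l))" for w
    proof -
      have "qform J B (\<lambda>k. \<Sum>i\<in>I. cnj (w i) * v (i, k)) =
        (\<Sum>k\<in>J. \<Sum>l\<in>J. \<Sum>j\<in>I. \<Sum>i\<in>I. cnj (v (i, k)) * (w i * cnj (w j) * B k l) * v (j, l))"
        unfolding qform_def cnj_sum sum_distrib_left sum_distrib_right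
        by (intro sum.cong refl) (simp add: algebra_simps)
      also have "\<dots> = (\<Sum>i\<in>I. \<Sum>k\<in>J. \<Sum>j\<in>I. \<Sum>l\<in>J. cnj (v (i, k)) * (w i * cnj (w j) * B k l) * v (j, l))"
        by (rule sum_rotate4)
      finally show ?thesis .
    qed
    have "qform (I \<times> J) (tensor A B) v = (\<Sum>i\<in>I. \<Sum>k\<in>J. \<Sum>j\<in>I. \<Sum>l\<in>J. \<Sum>q<r.
        cnj (v (i, k)) * (u q i * cnj (u q j) * B k l) * v (j, l))"
      by (simp only: qform_Times tensor_def split_conv u sum_distrib_left sum_distrib_right)
    also have "\<dots> = (\<Sum>i\<in>I. \<Sum>k\<in>J. \<Sum>q<r. \<Sum>j\<in>I. \<Sum>l\<in>J.
        cnj (v (i, k)) * (u q i * cnj (u q j) * B k l) * v (j, l))"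
      by (intro sum.cong refl sum_pull2)
    also have "\<dots> = (\<Sum>q<r. qform J B (\<lambda>k. \<Sum>i\<in>I. cnj (u q i) * v (i, k)))"
      unfolding 1 by (rule sum_pull2)
    finally show ?thesis .
  qed
  ultimately show ?thesis
    using assms(3) by (auto simp: psd_iff_qform intro!: nonneg_Reals_sum)
qed

lemma op_trace_mult: "op_trace I (op_mult I A B) = (\<Sum>i\<in>I. \<Sum>j\<in>I. A i j * B j i)"
  by (simp add: op_trace_def op_mult_def)

text \<open>Splitting \<open>A\<close> into rank-one terms makes the trace a sum of values of the
  form of \<open>B\<close>.\<close>

lemma psd_trace_mult_nonneg:
  assumes "finite I" "psd I A" "psd I B"
  shows "op_trace I (op_mult I A B) \<in> \<real>\<^sub>\<ge>\<^sub>0"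
proof -
  obtain r u where u: "A i j = (\<Sum>q<(r::nat). u q i * cnj (u q j))" for i j
    using psd_rank_one_decomposition[OF assms(1,2)] by blast
  have "op_trace I (op_mult I A B) = (\<Sum>i\<in>I. \<Sum>j\<in>I. \<Sum>q<r. u q i * cnj (u q j) * B j i)"
    unfolding op_trace_mult u sum_distrib_right ..
  also have "\<dots> = (\<Sum>q<r. \<Sum>i\<in>I. \<Sum>j\<in>I. u q i * cnj (u q j) * B j i)"
    by (rule sum_pull2)
  also have "\<dots> = (\<Sum>q<r. \<Sum>j\<in>I. \<Sum>i\<in>I. u q i * cnj (u q j) * B j i)"
    by (intro sum.cong refl sum.swap)
  also have "\<dots> = (\<Sum>q<r. qform I B (u q))"
    unfolding qform_def by (intro sum.cong refl) (simp add: algebra_simps)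
  finally have "op_trace I (op_mult I A B) = (\<Sum>q<r. qform I B (u q))" .
  then show ?thesis
    using assms(3) by (auto simp: psd_iff_qform intro!: nonneg_Reals_sum)
qed

subsection \<open>Sequential decoding\<close>

text \<open>The condition 0 \<le> T \<le> 1 for a self-adjoint T. A real inner product suffices for
  the union bound; complex vectors enter through the real part of their Hermitian product.\<close>

definition effect :: "('a::real_inner \<Rightarrow> 'a) \<Rightarrow> bool" where
  "effect T \<longleftrightarrow> linear T \<and> (\<forall>x y. x \<bullet> T y = T x \<bullet> y) \<and> (\<forall>x. 0 \<le> x \<bullet> T x \<and> x \<bullet> T x \<le> x \<bullet> x)"

lemma effect_complement:
  assumes "effect T"
  shows "effect (\<lambda>x. x - T x)"
  using assms by (auto simp: effect_def inner_diff intro: linear_compose_sub linear_ident)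

text \<open>This is T^2 \<le> T, from positivity of T at (1 - T) x and T \<le> 1 at T x.\<close>

lemma effect_norm_le:
  assumes "effect T"
  shows "T x \<bullet> T x \<le> x \<bullet> T x"
proof -
  have T: "linear T" "\<And>x y. T x \<bullet> y = x \<bullet> T y" "\<And>x. 0 \<le> x \<bullet> T x" "\<And>x. x \<bullet> T x \<le> x \<bullet> x"
    using assms by (auto simp: effect_def)
  have "0 \<le> (x - T x) \<bullet> T (x - T x)" by (rule T)
  also have "\<dots> = x \<bullet> T x - 2 * (T x \<bullet> T x) + T x \<bullet> T (T x)"
    by (simp add: linear_diff[OF T(1)] inner_diff T(2))
  finally show ?thesis using T(4)[of "T x"] by linarith
qed

lemma effect_cross:
  assumes "effect T"
  shows "v \<bullet> T w \<le> v \<bullet> T v + (w \<bullet> T w) / 4"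
proof -
  have T: "linear T" "\<And>x y. T x \<bullet> y = x \<bullet> T y" "\<And>x. 0 \<le> x \<bullet> T x"
    using assms by (auto simp: effect_def)
  have "0 \<le> (v - (1/2) *\<^sub>R w) \<bullet> T (v - (1/2) *\<^sub>R w)" by (rule T)
  also have "\<dots> = v \<bullet> T v - v \<bullet> T w + (w \<bullet> T w) / 4"
    using T(2)[of v w]
    by (simp add: linear_diff[OF T(1)] linear_scale[OF T(1)] inner_diff inner_commute field_simps)
  finally show ?thesis by linarith
qed

text \<open>The squared norm lost in a step is
  \<open>2 * (w \<bullet> T w) - T w \<bullet> T w\<close>, so both estimates follow from T^2 \<le>
  T.\<close>

lemma effect_step:
  assumes "effect T"
  shows "T w \<bullet> T w \<le> w \<bullet> w - (w - T w) \<bullet> (w - T w)"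
    and "w \<bullet> T w \<le> w \<bullet> w - (w - T w) \<bullet> (w - T w)"
proof -
  have "(w - T w) \<bullet> (w - T w) = w \<bullet> w - 2 * (w \<bullet> T w) + T w \<bullet> T w"
    by (simp add: inner_diff inner_commute)
  then show "T w \<bullet> T w \<le> w \<bullet> w - (w - T w) \<bullet> (w - T w)"
    and "w \<bullet> T w \<le> w \<bullet> w - (w - T w) \<bullet> (w - T w)"
    using effect_norm_le[OF assms, of w] by linarith+
qed

text \<open>Gao's quantum union bound, for the Kraus operators \<open>1 - T i\<close> instead of projections. The
  telescoping sum for \<open>v \<bullet> (v - w n)\<close> is estimated termwise by positivity of \<open>T i\<close> at
  \<open>v - w i / 2\<close>, and \<open>w i \<bullet> T i (w i)\<close> is at most the loss of norm in step \<open>i\<close>.\<close>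

lemma quantum_union_bound:
  fixes w :: "nat \<Rightarrow> 'a::real_inner"
  assumes "\<And>i. i < n \<Longrightarrow> effect (T i)" and "\<And>i. i < n \<Longrightarrow> w (Suc i) = w i - T i (w i)"
    and "w 0 = v"
  shows "v \<bullet> v - w n \<bullet> w n \<le> 4 * (\<Sum>i<n. v \<bullet> T i v)"
proof -
  have "v \<bullet> (v - w n) = (\<Sum>i<n. v \<bullet> T i (w i))"
  proof -
    have "v - w n = (\<Sum>i<n. w i - w (Suc i))"
      unfolding sum_lessThan_telescope' assms(3) ..
    also have "\<dots> = (\<Sum>i<n. T i (w i))"
      using assms(2) by (intro sum.cong) auto
    finally show ?thesis by (simp add: inner_sum_right)
  qed
  also have "\<dots> \<le> (\<Sum>i<n. v \<bullet> T i v + (w i \<bullet> w i - w (Suc i) \<bullet> w (Suc i)) / 4)"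
  proof (rule sum_mono)
    fix i assume "i \<in> {..<n}"
    then have i: "i < n" by simp
    show "v \<bullet> T i (w i) \<le> v \<bullet> T i v + (w i \<bullet> w i - w (Suc i) \<bullet> w (Suc i)) / 4"
      using effect_cross[OF assms(1)[OF i], of v "w i"] effect_step(2)[OF assms(1)[OF i], of "w i"]
      unfolding assms(2)[OF i] by argo
  qed
  also have "\<dots> = (\<Sum>i<n. v \<bullet> T i v) + (v \<bullet> v - w n \<bullet> w n) / 4"
    using sum_lessThan_telescope'[of "\<lambda>i. w i \<bullet> w i" n] assms(3)
    by (simp add: sum.distrib flip: sum_divide_distrib)
  finally have 1: "v \<bullet> v - v \<bullet> w n \<le> (\<Sum>i<n. v \<bullet> T i v) + (v \<bullet> v - w n \<bullet> w n) / 4"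
    by (simp add: inner_diff)
  \<comment> \<open>This bounds \<open>v \<bullet> w n\<close> by the mean of both squared norms.
    Half the norm loss is then at most the sum plus a quarter of the loss, which is where the factor
    4 comes from.\<close>
  have "0 \<le> (v - w n) \<bullet> (v - w n)" by simp
  then have "2 * (v \<bullet> w n) \<le> v \<bullet> v + w n \<bullet> w n"
    by (simp add: inner_diff inner_commute)
  then show ?thesis using 1 by argo
qed

text \<open>Outcome \<open>m\<close> means "no" to the tests before \<open>m\<close> and "yes" to
  test \<open>m\<close>. A "yes" to \<open>T m\<close> is a "no" to its complement, so the union
  bound covers the whole run. The decoder assigns the norm loss of step \<open>m\<close> to this
  outcome, which is at least the squared norm of \<open>T m (w m)\<close>.\<close>

lemma sequential_success:
  fixes w :: "nat \<Rightarrow> 'a::real_inner"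
  assumes "\<And>i. i \<le> m \<Longrightarrow> effect (T i)" and "\<And>i. i \<le> m \<Longrightarrow> w (Suc i) = w i - T i (w i)"
  shows "w 0 \<bullet> w 0 - (w m \<bullet> w m - w (Suc m) \<bullet> w (Suc m))
    \<le> 4 * (w 0 \<bullet> w 0 - w 0 \<bullet> T m (w 0)) + 4 * (\<Sum>i<m. w 0 \<bullet> T i (w 0))"
proof -
  define T' where "T' = T(m := \<lambda>x. x - T m x)"
  define w' where "w' = w(Suc m := T m (w m))"
  have "w' 0 \<bullet> w' 0 - w' (Suc m) \<bullet> w' (Suc m) \<le> 4 * (\<Sum>i<Suc m. w' 0 \<bullet> T' i (w' 0))"
  proof (rule quantum_union_bound)
    fix i assume i: "i < Suc m"
    show "effect (T' i)" using assms(1)[of i] effect_complement[OF assms(1), of m] i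
      by (auto simp: T'_def)
    show "w' (Suc i) = w' i - T' i (w' i)" using assms(2)[of i] i
      by (auto simp: T'_def w'_def)
  qed simp
  then have "w 0 \<bullet> w 0 - T m (w m) \<bullet> T m (w m) \<le> 4 * (\<Sum>i<m. w 0 \<bullet> T i (w 0)) +
     4 * (w 0 \<bullet> w 0 - w 0 \<bullet> T m (w 0))"
    by (simp add: T'_def w'_def inner_diff)
  moreover have "T m (w m) \<bullet> T m (w m) \<le> w m \<bullet> w m - w (Suc m) \<bullet> w (Suc m)"
    using effect_step(1)[OF assms(1), of m "w m"] assms(2)[of m] by simp
  ultimately show ?thesis by linarith
qed

section \<open>Matrices acting on complex vectors\<close>

definition vapp :: "'i::finite oper \<Rightarrow> complex^'i \<Rightarrow> complex^'i" where
  "vapp A x = (\<chi> i. \<Sum>j\<in>UNIV. A i j * x $ j)"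

lemma linear_vapp: "linear (vapp A)"
  by (rule linearI) (simp_all add: vapp_def vec_eq_iff algebra_simps sum.distrib scaleR_sum_right)

lemma inner_complex_vec: "(x::complex^'i::finite) \<bullet> y = Re (\<Sum>i\<in>UNIV. cnj (x $ i) * y $ i)"
  by (simp add: inner_vec_def inner_complex_def)

lemma qform_vapp:
  "qform UNIV A v = (\<Sum>i\<in>UNIV. cnj (v i) * vapp A (\<chi> i. v i) $ i)"
  by (simp add: qform_def vapp_def sum_distrib_left mult.assoc)

lemma psd_qform_inner:
  assumes "psd UNIV A"
  shows "qform UNIV A v = of_real ((\<chi> i. v i) \<bullet> vapp A (\<chi> i. v i))"
  using assms by (auto simp: psd_iff_qform inner_complex_vec qform_vapp complex_nonneg_Reals_iff complex_eq_iff)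

lemma vapp_self_adjoint:
  assumes "psd UNIV A"
  shows "x \<bullet> vapp A y = vapp A x \<bullet> y"
proof -
  have "(\<Sum>i\<in>UNIV. cnj (x $ i) * vapp A y $ i) = (\<Sum>i\<in>UNIV. \<Sum>j\<in>UNIV. cnj (x $ i) * A i j * y $ j)"
    by (simp add: vapp_def sum_distrib_left mult.assoc)
  also have "\<dots> = (\<Sum>j\<in>UNIV. \<Sum>i\<in>UNIV. cnj (x $ i) * A i j * y $ j)"
    by (rule sum.swap)
  also have "\<dots> = (\<Sum>j\<in>UNIV. cnj (vapp A x $ j) * y $ j)"
  proof (intro sum.cong refl)
    fix j
    have "A i j = cnj (A j i)" for i by (rule psd_hermitian[OF finite assms])
    then show "(\<Sum>i\<in>UNIV. cnj (x $ i) * A i j * y $ j) = cnj (vapp A x $ j) * y $ j"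
      by (simp add: vapp_def sum_distrib_left mult_ac)
  qed
  finally show ?thesis by (simp add: inner_complex_vec)
qed

lemma vapp_op_diff: "vapp (op_diff A B) x = vapp A x - vapp B x"
  by (simp add: vapp_def op_diff_def vec_eq_iff algebra_simps sum_subtractf)

lemma vapp_id_op [simp]: "vapp (id_op UNIV) x = x"
  by (simp add: vapp_def id_op_def vec_eq_iff if_distrib[of "\<lambda>x. x * _"] cong: if_cong)

lemma psd_inner_nonneg:
  assumes "psd UNIV A"
  shows "0 \<le> x \<bullet> vapp A x"
  using assms psd_qform_inner[OF assms, of "\<lambda>i. x $ i"] by (auto simp: psd_iff_qform dest: spec[of _ "\<lambda>i. x $ i"])

definition test :: "'i::finite oper \<Rightarrow> bool" where
  "test A \<longleftrightarrow> psd UNIV A \<and> psd UNIV (op_diff (id_op UNIV) A)"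

lemma effect_vapp:
  assumes "test A"
  shows "effect (vapp A)"
proof -
  have "0 \<le> x \<bullet> (x - vapp A x)" for x
    using psd_inner_nonneg[of "op_diff (id_op UNIV) A" x] assms by (simp add: test_def vapp_op_diff)
  then show ?thesis
    using assms linear_vapp[of A] vapp_self_adjoint[of A] psd_inner_nonneg[of A]
    by (simp add: effect_def test_def inner_diff)
qed

text \<open>The product of the adjoint of \<open>S\<close> with \<open>S\<close>, whose form is the
  squared norm of the image under \<open>S\<close>.\<close>

definition gram :: "'i::finite oper \<Rightarrow> 'i oper" where
  "gram S = (\<lambda>i j. \<Sum>k\<in>UNIV. cnj (S k i) * S k j)"

lemma qform_gram: "qform UNIV (gram S) v = of_real (vapp S (\<chi> i. v i) \<bullet> vapp S (\<chi> i. v i))"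
proof -
  have "qform UNIV (gram S) v = (\<Sum>i\<in>UNIV. \<Sum>j\<in>UNIV. \<Sum>k\<in>UNIV. cnj (v i) * (cnj (S k i) * S k j) * v j)"
    by (simp add: qform_def gram_def sum_distrib_left sum_distrib_right)
  also have "\<dots> = (\<Sum>k\<in>UNIV. \<Sum>i\<in>UNIV. \<Sum>j\<in>UNIV. cnj (v i) * (cnj (S k i) * S k j) * v j)"
    by (rule sum_pull2)
  also have "\<dots> = (\<Sum>k\<in>UNIV. cnj (vapp S (\<chi> i. v i) $ k) * vapp S (\<chi> i. v i) $ k)"
    by (intro sum.cong refl, simp add: vapp_def sum_product mult_ac, rule sum.swap)
  also have "\<dots> = of_real (vapp S (\<chi> i. v i) \<bullet> vapp S (\<chi> i. v i))"
    by (simp add: inner_complex_vec complex_eq_iff mult.commute)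
  finally show ?thesis .
qed

lemma qform_linear:
  "qform I (\<lambda>i j. A i j + B i j) v = qform I A v + qform I B v"
  "qform I (\<lambda>i j. A i j - B i j) v = qform I A v - qform I B v"
  "qform I (\<lambda>i j. c * A i j) v = c * qform I A v"
  "qform I (\<lambda>i j. \<Sum>x\<in>X. F x i j) v = (\<Sum>x\<in>X. qform I (F x) v)"
proof -
  show "qform I (\<lambda>i j. \<Sum>x\<in>X. F x i j) v = (\<Sum>x\<in>X. qform I (F x) v)"
    unfolding qform_def sum_distrib_left sum_distrib_right by (rule sum_pull2)
  show "qform I (\<lambda>i j. A i j + B i j) v = qform I A v + qform I B v"
    by (simp add: qform_def distrib_left distrib_right sum.distrib)
  show "qform I (\<lambda>i j. A i j - B i j) v = qform I A v - qform I B v"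
    by (simp add: qform_def left_diff_distrib right_diff_distrib sum_subtractf)
  show "qform I (\<lambda>i j. c * A i j) v = c * qform I A v"
    unfolding qform_def sum_distrib_left by (intro sum.cong refl) (simp only: mult_ac)
qed

text \<open>Measuring the tests one after the other with the Kraus operators \<open>1 - P m\<close> for the outcome
  ``no'' needs no operator square roots.\<close>

primrec no_ops :: "(nat \<Rightarrow> 'i::finite oper) \<Rightarrow> nat \<Rightarrow> 'i oper" where
  "no_ops P 0 = id_op UNIV"
| "no_ops P (Suc m) = op_diff (no_ops P m) (op_mult UNIV (P m) (no_ops P m))"

lemma vapp_op_mult: "vapp (op_mult UNIV A B) x = vapp A (vapp B x)"
proof -
  have "(\<Sum>j\<in>UNIV. (\<Sum>k\<in>UNIV. A i k * B k j) * x $ j) = (\<Sum>k\<in>UNIV. A i k * (\<Sum>j\<in>UNIV. B k j * x $ j))" for i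
    unfolding sum_distrib_left sum_distrib_right by (subst sum.swap) (simp add: mult.assoc)
  then show ?thesis by (simp add: vapp_def op_mult_def)
qed

lemma gram_id_op [simp]: "gram (id_op UNIV) = id_op UNIV"
proof -
  have "(\<Sum>k\<in>UNIV. cnj (id_op UNIV k i) * id_op UNIV k j) =
    (\<Sum>k\<in>UNIV. if k = i then if i = j then 1 else 0 else (0::complex))" for i j :: 'a
    by (intro sum.cong) (auto simp: id_op_def)
  then show ?thesis by (simp add: gram_def id_op_def fun_eq_iff)
qed

lemma psd_UNIVI:
  assumes "\<And>v. \<exists>r\<ge>0. qform UNIV A v = of_real r"
  shows "psd UNIV A"
proof -
  have "qform UNIV A v \<in> \<real>\<^sub>\<ge>\<^sub>0" for v using assms[of v] by auto
  then show ?thesis by (simp add: psd_iff_qform operators_def)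
qed

text \<open>The element of outcome \<open>m\<close> is the norm loss of step \<open>m\<close> as an
  operator, a difference of consecutive Gram operators. Positivity and the error bound are checked
  on forms; completeness is a telescoping sum. As an operator inequality, the error bound is
  available in every state at once.\<close>

lemma sequential_decoder:
  fixes P :: "nat \<Rightarrow> 'i::finite oper"
  assumes P: "\<And>m. m < K \<Longrightarrow> test (P m)" and "K \<ge> 1"
  obtains E where "povm UNIV {..<K} E"
    and "\<And>m. m < K \<Longrightarrow> psd UNIV (\<lambda>i j. 4 * (id_op UNIV i j - P m i j)
      + 4 * (\<Sum>m'\<in>{..<K}-{m}. P m' i j) - (id_op UNIV i j - E m i j))"
proof -
  define G where "G m = gram (no_ops P m)" for m
  \<comment> \<open>The event that all tests say "no" is credited to outcome 0, which closes the
    telescoping sum and can only raise the success probability.\<close>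
  define E where "E m = (\<lambda>i j. G m i j - G (Suc m) i j + (if m = 0 then G K i j else 0))" for m
  have psum: "(\<lambda>i j. \<Sum>m<K. E m i j) = id_op UNIV"
  proof (intro ext)
    fix i j
    have "(\<Sum>m<K. E m i j) = (\<Sum>m<K. G m i j - G (Suc m) i j) + G K i j"
      using \<open>K \<ge> 1\<close> by (simp add: E_def sum.distrib)
    also have "\<dots> = G 0 i j" by (simp add: sum_lessThan_telescope'[of "\<lambda>m. G m i j"])
    finally show "(\<Sum>m<K. E m i j) = id_op UNIV i j" by (simp add: G_def)
  qed
  define w where "w v m = vapp (no_ops P m) (\<chi> i. v i)" for v m
  have w0: "w v 0 = (\<chi> i. v i)" for v by (simp add: w_def)
  have wS: "w v (Suc m) = w v m - vapp (P m) (w v m)" for v m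
    by (simp add: w_def vapp_op_diff vapp_op_mult)
  have qG: "qform UNIV (G m) v = of_real (w v m \<bullet> w v m)" for m v
    by (simp add: G_def w_def qform_gram)
  define e where "e v m = w v m \<bullet> w v m - w v (Suc m) \<bullet> w v (Suc m) + (if m = 0 then w v K \<bullet> w v K else 0)" for v m
  have qE: "qform UNIV (E m) v = of_real (e v m)" for m v
    unfolding E_def qform_linear e_def by (cases "m = 0") (simp_all add: qG, simp add: qform_def)
  have eff: "effect (vapp (P m))" if "m < K" for m
    using that P effect_vapp by blast
  have psdE: "psd UNIV (E m)" if "m < K" for m
  proof (rule psd_UNIVI)
    fix v
    have "w v (Suc m) \<bullet> w v (Suc m) \<le> w v m \<bullet> w v m"
      using effect_step(1)[OF eff[OF that], of "w v m"] inner_ge_zero[of "vapp (P m) (w v m)"]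
      unfolding wS by linarith
    then have "e v m \<ge> 0" by (simp add: e_def add_increasing2)
    then show "\<exists>r\<ge>0. qform UNIV (E m) v = of_real r" using qE by blast
  qed
  have bound: "psd UNIV (\<lambda>i j. 4 * (id_op UNIV i j - P m i j)
      + 4 * (\<Sum>m'\<in>{..<K}-{m}. P m' i j) - (id_op UNIV i j - E m i j))" (is "psd UNIV ?B")
    if m: "m < K" for m
  proof (rule psd_UNIVI)
    fix v :: "'i \<Rightarrow> complex"
    let ?x = "\<chi> i. v i"
    let ?r = "4 * (?x \<bullet> ?x - ?x \<bullet> vapp (P m) ?x) + 4 * (\<Sum>m'\<in>{..<K}-{m}. ?x \<bullet> vapp (P m') ?x) - (?x \<bullet> ?x - e v m)"
    have id: "qform UNIV (id_op UNIV) v = of_real (?x \<bullet> ?x)"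
      using qform_gram[of "id_op UNIV" v] by simp
    have pos: "psd UNIV (P m')" if "m' < K" for m' using P[OF that] by (simp add: test_def)
    have "qform UNIV ?B v = of_real ?r"
      unfolding qform_linear id qE psd_qform_inner[OF pos[OF m]]
      by (simp add: psd_qform_inner[OF pos])
    moreover have "?r \<ge> 0"
    proof -
      have "w v 0 \<bullet> w v 0 - (w v m \<bullet> w v m - w v (Suc m) \<bullet> w v (Suc m))
        \<le> 4 * (w v 0 \<bullet> w v 0 - w v 0 \<bullet> vapp (P m) (w v 0)) + 4 * (\<Sum>i<m. w v 0 \<bullet> vapp (P i) (w v 0))"
        using eff m wS by (intro sequential_success) auto
      moreover have "(\<Sum>i<m. w v 0 \<bullet> vapp (P i) (w v 0)) \<le> (\<Sum>i\<in>{..<K}-{m}. w v 0 \<bullet> vapp (P i) (w v 0))"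
        using m pos by (intro sum_mono2) (auto intro: psd_inner_nonneg)
      moreover have "w v m \<bullet> w v m - w v (Suc m) \<bullet> w v (Suc m) \<le> e v m"
        by (simp add: e_def)
      ultimately show ?thesis unfolding w0 by linarith
    qed
    ultimately show "\<exists>r\<ge>0. qform UNIV ?B v = of_real r" by blast
  qed
  show thesis
    using that[of E] psdE psum bound by (simp add: povm_def)
qed

subsection \<open>Random superposition codes\<close>

definition wavg :: "'a set \<Rightarrow> ('a \<Rightarrow> real) \<Rightarrow> ('a \<Rightarrow> real) \<Rightarrow> real" where
  "wavg A w h = (\<Sum>x\<in>A. w x * h x)"

lemma wavg_add: "wavg A w (\<lambda>x. g x + h x) = wavg A w g + wavg A w h"
  by (simp add: wavg_def distrib_left sum.distrib)

lemma wavg_diff: "wavg A w (\<lambda>x. g x - h x) = wavg A w g - wavg A w h"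
  by (simp add: wavg_def right_diff_distrib sum_subtractf)

lemma wavg_cmult: "wavg A w (\<lambda>x. c * h x) = c * wavg A w h"
  by (simp add: wavg_def sum_distrib_left mult_ac)

lemma wavg_sum: "wavg A w (\<lambda>x. \<Sum>i\<in>I. h i x) = (\<Sum>i\<in>I. wavg A w (h i))"
  unfolding wavg_def sum_distrib_left by (rule sum.swap)

lemma wavg_const: "sum w A = 1 \<Longrightarrow> wavg A w (\<lambda>_. c) = c"
  by (simp add: wavg_def flip: sum_distrib_right)

lemma wavg_Times:
  "wavg (A \<times> B) (\<lambda>(x, y). u x * w x y) h = wavg A u (\<lambda>x. wavg B (w x) (\<lambda>y. h (x, y)))"
  by (simp add: wavg_def sum.cartesian_product' sum_distrib_left mult.assoc)

text \<open>Derandomisation: if every value exceeded the average, a point of positive weight would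
  make the average exceed itself.\<close>

lemma wavg_exists_le:
  assumes "finite A" "\<And>x. x \<in> A \<Longrightarrow> w x \<ge> 0" "sum w A = 1"
  shows "\<exists>x\<in>A. h x \<le> wavg A w h"
proof (rule ccontr)
  assume "\<not> ?thesis"
  then have gt: "h x > wavg A w h" if "x \<in> A" for x using that by force
  have "\<exists>x\<in>A. w x > 0"
    using assms by (metis linorder_not_le order_antisym sum.neutral zero_neq_one)
  then obtain x where x: "x \<in> A" "w x > 0" by blast
  have "wavg A w (\<lambda>_. wavg A w h) < wavg A w h"
    unfolding wavg_def[of A w "\<lambda>_. _"] wavg_def[of A w h, symmetric]
  proof (subst (2) wavg_def, rule sum_strict_mono_ex1[OF assms(1)])
    show "\<forall>x\<in>A. w x * wavg A w h \<le> w x * h x"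
      using assms(2) gt by (simp add: mult_left_mono less_imp_le)
    show "\<exists>x\<in>A. w x * wavg A w h < w x * h x"
      using x gt by (auto intro!: bexI[of _ x] mult_strict_left_mono)
  qed
  then show False using wavg_const[OF assms(3)] by simp
qed

lemma sum_PiE_insert:
  assumes "a \<notin> A"
  shows "(\<Sum>f\<in>PiE (insert a A) B. h f) = (\<Sum>x\<in>B a. \<Sum>g\<in>PiE A B. h (g(a := x)))"
proof -
  have "(\<Sum>f\<in>PiE (insert a A) B. h f) = (\<Sum>z\<in>B a \<times> PiE A B. h ((\<lambda>(y, g). g(a := y)) z))"
    unfolding PiE_insert_eq by (rule sum.reindex[OF inj_combinator[OF assms], unfolded o_def])
  then show ?thesis by (simp add: sum.cartesian_product')
qed

text \<open>Fubini for one coordinate of an i.i.d. law. Applied once or twice, it isolates the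
  coordinates of interest, and the others integrate to 1.\<close>

lemma wavg_PiE_insert:
  assumes "a \<notin> A" "finite A"
  shows "wavg (PiE (insert a A) (\<lambda>_. B)) (\<lambda>f. \<Prod>k\<in>insert a A. w (f k)) h =
    wavg B w (\<lambda>x. wavg (PiE A (\<lambda>_. B)) (\<lambda>f. \<Prod>k\<in>A. w (f k)) (\<lambda>g. h (g(a := x))))"
proof -
  have "(\<Prod>k\<in>insert a A. w ((g(a := x)) k)) = w x * (\<Prod>k\<in>A. w (g k))" for g x
  proof -
    have "(\<Prod>k\<in>A. w ((g(a := x)) k)) = (\<Prod>k\<in>A. w (g k))"
      using assms(1) by (intro prod.cong) auto
    then show ?thesis using assms by simp
  qed
  then show ?thesis
    unfolding wavg_def sum_PiE_insert[OF assms(1)] sum_distrib_left by (simp add: mult.assoc)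
qed

lemma sum_PiE_weights:
  assumes "finite A" "finite B" "sum w B = (1::real)"
  shows "(\<Sum>f\<in>PiE A (\<lambda>_. B). \<Prod>k\<in>A. w (f k)) = 1"
  using prod_sum_PiE[of A "\<lambda>_. B" "\<lambda>_. w"] assms by simp

lemma wavg_PiE_coordinate:
  assumes "finite A" "finite B" "sum w B = 1" "i \<in> A"
  shows "wavg (PiE A (\<lambda>_. B)) (\<lambda>f. \<Prod>k\<in>A. w (f k)) (\<lambda>f. h (f i)) = wavg B w h"
proof -
  define A' where "A' = A - {i}"
  have A: "A = insert i A'" "i \<notin> A'" "finite A'" using assms by (auto simp: A'_def)
  show ?thesis
    unfolding A(1) wavg_PiE_insert[OF A(2,3)]
    using wavg_const[OF sum_PiE_weights[OF A(3) assms(2,3)]] by simp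
qed

lemma wavg_PiE_two_coordinates:
  assumes "finite A" "finite B" "sum w B = 1" "i \<in> A" "j \<in> A" "i \<noteq> j"
  shows "wavg (PiE A (\<lambda>_. B)) (\<lambda>f. \<Prod>k\<in>A. w (f k)) (\<lambda>f. h (f i) (f j)) =
    wavg B w (\<lambda>x. wavg B w (h x))"
proof -
  define A' where "A' = A - {i}"
  have A: "A = insert i A'" "i \<notin> A'" "finite A'" "j \<in> A'" using assms by (auto simp: A'_def)
  show ?thesis
    unfolding A(1) wavg_PiE_insert[OF A(2,3)]
    using wavg_PiE_coordinate[OF A(3) assms(2,3) A(4)] assms(6) by simp
qed

text \<open>A random code does it on average: the cloud centres \<open>x m'\<close> are independent with law \<open>p\<close>,
  and given these the satellites \<open>y m' m\<close> are independent with law \<open>c (x m')\<close>.\<close>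

lemma superposition_codebook:
  fixes p :: "'x::finite \<Rightarrow> real" and c :: "'x \<Rightarrow> 'y::finite \<Rightarrow> real"
    and \<alpha> :: "'x \<Rightarrow> 'x \<Rightarrow> 'y \<Rightarrow> real" and \<beta> :: "'x \<Rightarrow> 'y \<Rightarrow> 'y \<Rightarrow> real"
  assumes p: "\<And>x. p x \<ge> 0" "sum p UNIV = 1"
    and c: "\<And>x y. c x y \<ge> 0" "\<And>x. sum (c x) UNIV = 1"
    and K: "K \<ge> (1::nat)"
  obtains x y where
    "(\<Sum>m'<K. \<Sum>m<K.
        4 * (1 - \<alpha> (x m') (x m') (y m' m)) + 4 * (\<Sum>l\<in>{..<K}-{m'}. \<alpha> (x l) (x m') (y m' m)) +
        (4 * (1 - \<beta> (x m') (y m' m) (y m' m)) + 4 * (\<Sum>l\<in>{..<K}-{m}. \<beta> (x m') (y m' l) (y m' m))))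
     \<le> (real K)\<^sup>2 *
       (4 * (1 - wavg UNIV p (\<lambda>s. wavg UNIV (c s) (\<alpha> s s))) +
        4 * (real K - 1) * wavg UNIV p (\<lambda>r. wavg UNIV p (\<lambda>s. wavg UNIV (c s) (\<alpha> r s))) +
        (4 * (1 - wavg UNIV p (\<lambda>s. wavg UNIV (c s) (\<lambda>t. \<beta> s t t))) +
         4 * (real K - 1) * wavg UNIV p (\<lambda>s. wavg UNIV (c s) (\<lambda>r. wavg UNIV (c s) (\<beta> s r)))))"
proof -
  define G where "G = PiE {..<K} (\<lambda>_. UNIV :: 'y set)"
  define V where "V s g = (\<Prod>m<K. c s (g m))" for s and g :: "nat \<Rightarrow> 'y"
  \<comment> \<open>A point of \<open>B\<close> is a cloud centre with all its satellites, and
    \<open>W\<close> is the law of such a cloud. Under \<open>U\<close> the \<open>K\<close> clouds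
    are independent copies.\<close>
  define B where "B = (UNIV :: 'x set) \<times> G"
  define W where "W = (\<lambda>(s, g). p s * V s g)"
  define F where "F = PiE {..<K} (\<lambda>_. B)"
  define U where "U f = (\<Prod>m<K. W (f m))" for f :: "nat \<Rightarrow> 'x \<times> (nat \<Rightarrow> 'y)"
  have fG: "finite G" unfolding G_def by (intro finite_PiE) auto
  have fB: "finite B" unfolding B_def using fG by simp
  have fF: "finite F" unfolding F_def using fB by (intro finite_PiE) auto
  have V1: "sum (V s) G = 1" for s
    unfolding V_def G_def using c by (intro sum_PiE_weights) auto
  have W1: "sum W B = 1"
    unfolding W_def B_def using wavg_Times[of UNIV G p V "\<lambda>_. 1"] V1 p(2)
    by (simp add: wavg_def split_def)
  have U1: "sum U F = 1"
    unfolding U_def F_def using fB W1 by (intro sum_PiE_weights) auto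
  have U0: "U f \<ge> 0" for f
    unfolding U_def W_def V_def using p(1) c(1) by (auto intro!: prod_nonneg mult_nonneg_nonneg split: prod.split)
  have V_1: "wavg G (V s) (\<lambda>g. h (g m)) = wavg UNIV (c s) h" if "m < K" for s h m
    unfolding G_def V_def using that c by (intro wavg_PiE_coordinate) auto
  have V_2: "wavg G (V s) (\<lambda>g. h (g l) (g m)) = wavg UNIV (c s) (\<lambda>x. wavg UNIV (c s) (h x))"
    if "m < K" "l < K" "l \<noteq> m" for s h m l
    unfolding G_def V_def using that c by (intro wavg_PiE_two_coordinates) auto
  have U_1: "wavg F U (\<lambda>f. h (f m)) = wavg UNIV p (\<lambda>s. wavg G (V s) (\<lambda>g. h (s, g)))"
    if "m < K" for h m
    unfolding F_def U_def using that fB W1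
    by (subst wavg_PiE_coordinate) (auto simp: W_def B_def wavg_Times)
  have U_2: "wavg F U (\<lambda>f. h (f l) (f m)) =
      wavg UNIV p (\<lambda>r. wavg G (V r) (\<lambda>g'. wavg UNIV p (\<lambda>s. wavg G (V s) (\<lambda>g. h (r, g') (s, g)))))"
    if "m < K" "l < K" "l \<noteq> m" for h m l
    unfolding F_def U_def using that fB W1
    by (subst wavg_PiE_two_coordinates) (auto simp: W_def B_def wavg_Times)
  define H where "H f = (\<Sum>m'<K. \<Sum>m<K.
      4 * (1 - \<alpha> (fst (f m')) (fst (f m')) (snd (f m') m)) +
      4 * (\<Sum>l\<in>{..<K}-{m'}. \<alpha> (fst (f l)) (fst (f m')) (snd (f m') m)) +
      (4 * (1 - \<beta> (fst (f m')) (snd (f m') m) (snd (f m') m)) +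
       4 * (\<Sum>l\<in>{..<K}-{m}. \<beta> (fst (f m')) (snd (f m') l) (snd (f m') m))))"
    for f :: "nat \<Rightarrow> 'x \<times> (nat \<Rightarrow> 'y)"
  have e1: "wavg F U (\<lambda>f. \<alpha> (fst (f m')) (fst (f m')) (snd (f m') m)) =
      wavg UNIV p (\<lambda>s. wavg UNIV (c s) (\<alpha> s s))" if "m' < K" "m < K" for m' m
    using U_1[OF that(1), of "\<lambda>u. \<alpha> (fst u) (fst u) (snd u m)"] V_1[OF that(2)] by simp
  \<comment> \<open>A wrong cloud centre is independent of the pair that was sent.\<close>
  have e2: "wavg F U (\<lambda>f. \<alpha> (fst (f l)) (fst (f m')) (snd (f m') m)) =
      wavg UNIV p (\<lambda>r. wavg UNIV p (\<lambda>s. wavg UNIV (c s) (\<alpha> r s)))" if "m' < K" "m < K" "l < K" "l \<noteq> m'" for m' m l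
    using U_2[OF that(1,3,4), of "\<lambda>u v. \<alpha> (fst u) (fst v) (snd v m)"] V_1[OF that(2)] wavg_const[OF V1] by simp
  have e3: "wavg F U (\<lambda>f. \<beta> (fst (f m')) (snd (f m') m) (snd (f m') m)) =
      wavg UNIV p (\<lambda>s. wavg UNIV (c s) (\<lambda>t. \<beta> s t t))" if "m' < K" "m < K" for m' m
    using U_1[OF that(1), of "\<lambda>u. \<beta> (fst u) (snd u m) (snd u m)"] V_1[OF that(2), where h="\<lambda>t. \<beta> _ t t"] by simp
  \<comment> \<open>A wrong satellite shares its centre with the satellite that was sent and, given
    the centre, is independent of it.\<close>
  have e4: "wavg F U (\<lambda>f. \<beta> (fst (f m')) (snd (f m') l) (snd (f m') m)) =
      wavg UNIV p (\<lambda>s. wavg UNIV (c s) (\<lambda>r. wavg UNIV (c s) (\<beta> s r)))" if "m' < K" "m < K" "l < K" "l \<noteq> m" for m' m l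
    using U_1[OF that(1), of "\<lambda>u. \<beta> (fst u) (snd u l) (snd u m)"] V_2[OF that(2-4)] by simp
  have "wavg F U H = (\<Sum>m'<K. \<Sum>m<K.
      4 * (1 - wavg UNIV p (\<lambda>s. wavg UNIV (c s) (\<alpha> s s))) +
      4 * (\<Sum>l\<in>{..<K}-{m'}. wavg UNIV p (\<lambda>r. wavg UNIV p (\<lambda>s. wavg UNIV (c s) (\<alpha> r s)))) +
      (4 * (1 - wavg UNIV p (\<lambda>s. wavg UNIV (c s) (\<lambda>t. \<beta> s t t))) +
       4 * (\<Sum>l\<in>{..<K}-{m}. wavg UNIV p (\<lambda>s. wavg UNIV (c s) (\<lambda>r. wavg UNIV (c s) (\<beta> s r))))))"
    unfolding H_def wavg_sum wavg_add wavg_diff wavg_cmult wavg_const[OF U1]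
    by (intro sum.cong refl arg_cong2[of _ _ _ _ "(+)"] arg_cong2[of _ _ _ _ "(*)"] arg_cong2[of _ _ _ _ "(-)"] e1 e2 e3 e4) auto
  also have "\<dots> = (real K)\<^sup>2 *
       (4 * (1 - wavg UNIV p (\<lambda>s. wavg UNIV (c s) (\<alpha> s s))) +
        4 * (real K - 1) * wavg UNIV p (\<lambda>r. wavg UNIV p (\<lambda>s. wavg UNIV (c s) (\<alpha> r s))) +
        (4 * (1 - wavg UNIV p (\<lambda>s. wavg UNIV (c s) (\<lambda>t. \<beta> s t t))) +
         4 * (real K - 1) * wavg UNIV p (\<lambda>s. wavg UNIV (c s) (\<lambda>r. wavg UNIV (c s) (\<beta> s r)))))"
    (is "?L = (real K)\<^sup>2 * ?R")
  proof -
    have "?L = (\<Sum>m'<K. \<Sum>m<K. ?R)"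
      using K by (intro sum.cong refl) (simp add: of_nat_diff algebra_simps)
    then show ?thesis by (simp add: power2_eq_square)
  qed
  finally have avg: "wavg F U H = (real K)\<^sup>2 * ?R" .
  obtain f where "f \<in> F" "H f \<le> wavg F U H"
    using wavg_exists_le[OF fF U0 U1, of H] by blast
  then show thesis
    unfolding avg by (intro that[of "\<lambda>m. fst (f m)" "\<lambda>m. snd (f m)"]) (simp only: H_def)
qed

text \<open>With independent uniform messages at the indices 0 to \<open>b\<close>, every block sees
  a uniform pair, so the mean total error is at most \<open>b * \<eta>\<close>. Choosing the two
  boundary values one after the other does not raise the mean over the inner messages.\<close>

lemma fix_boundary_messages:
  fixes e :: "nat \<Rightarrow> nat \<Rightarrow> real"
  assumes e: "(\<Sum>m'<K. \<Sum>m<K. e m' m) \<le> (real K)\<^sup>2 * \<eta>" and K: "K \<ge> (1::nat)" and b: "b \<ge> (1::nat)"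
  obtains m\<^sub>0 m\<^sub>b where "m\<^sub>0 < K" "m\<^sub>b < K"
    "(\<Sum>f\<in>PiE {1..<b} (\<lambda>_. {..<K}). \<Sum>j<b. e ((f(b := m\<^sub>b, 0 := m\<^sub>0)) j) ((f(b := m\<^sub>b, 0 := m\<^sub>0)) (Suc j)))
      \<le> real K ^ (b - 1) * (real b * \<eta>)"
proof -
  let ?w = "\<lambda>_::nat. 1 / real K"
  let ?B = "{..<K}"
  have w1: "sum ?w ?B = 1" using K by simp
  define H where "H f = (\<Sum>j<b. e (f j) (f (Suc j)))" for f :: "nat \<Rightarrow> nat"
  have two: "wavg ?B ?w (\<lambda>x. wavg ?B ?w (e x)) \<le> \<eta>"
  proof -
    have "wavg ?B ?w (\<lambda>x. wavg ?B ?w (e x)) = (\<Sum>m'<K. \<Sum>m<K. e m' m) / (real K)\<^sup>2"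
      by (simp add: wavg_def sum_divide_distrib power2_eq_square)
    also have "\<dots> \<le> \<eta>" using e K by (simp add: field_simps)
    finally show ?thesis .
  qed
  \<comment> \<open>This is {0..b}, built so that both boundary coordinates can be split off by
    Fubini.\<close>
  define A where "A = insert 0 (insert b {1..<b})"
  have A: "finite A" "\<And>j. j < b \<Longrightarrow> j \<in> A \<and> Suc j \<in> A" using b by (auto simp: A_def)
  have "wavg (PiE A (\<lambda>_. ?B)) (\<lambda>f. \<Prod>k\<in>A. ?w (f k)) H = (\<Sum>j<b. wavg ?B ?w (\<lambda>x. wavg ?B ?w (e x)))"
    unfolding H_def wavg_sum using A w1 by (intro sum.cong refl wavg_PiE_two_coordinates) auto
  also have "\<dots> \<le> real b * \<eta>" using sum_mono[of "{..<b}", OF two] by simp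
  finally have "wavg (PiE A (\<lambda>_. ?B)) (\<lambda>f. \<Prod>k\<in>A. ?w (f k)) H \<le> real b * \<eta>" .
  moreover have "wavg (PiE A (\<lambda>_. ?B)) (\<lambda>f. \<Prod>k\<in>A. ?w (f k)) H = wavg ?B ?w (\<lambda>x. wavg ?B ?w (\<lambda>y.
      wavg (PiE {1..<b} (\<lambda>_. ?B)) (\<lambda>f. \<Prod>k\<in>{1..<b}. ?w (f k)) (\<lambda>f. H (f(b := y, 0 := x)))))"
  proof -
    have 0: "0 \<notin> insert b {1..<b}" "finite (insert b {1..<b})" "b \<notin> {1..<b}" "finite {1..<b}"
      using b by auto
    show ?thesis
      unfolding A_def wavg_PiE_insert[OF 0(1,2), where w = ?w] wavg_PiE_insert[OF 0(3,4), where w = ?w] ..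
  qed
  moreover obtain x where x: "x < K" "wavg ?B ?w (\<lambda>y.
      wavg (PiE {1..<b} (\<lambda>_. ?B)) (\<lambda>f. \<Prod>k\<in>{1..<b}. ?w (f k)) (\<lambda>f. H (f(b := y, 0 := x)))) \<le> 
      wavg ?B ?w (\<lambda>x. wavg ?B ?w (\<lambda>y.
      wavg (PiE {1..<b} (\<lambda>_. ?B)) (\<lambda>f. \<Prod>k\<in>{1..<b}. ?w (f k)) (\<lambda>f. H (f(b := y, 0 := x)))))"
    using wavg_exists_le[OF finite_lessThan _ w1] by (metis (no_types, lifting) lessThan_iff of_nat_0_le_iff zero_le_divide_1_iff)
  moreover obtain y where y: "y < K" 
      "wavg (PiE {1..<b} (\<lambda>_. ?B)) (\<lambda>f. \<Prod>k\<in>{1..<b}. ?w (f k)) (\<lambda>f. H (f(b := y, 0 := x))) \<le> wavg ?B ?w (\<lambda>y.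
      wavg (PiE {1..<b} (\<lambda>_. ?B)) (\<lambda>f. \<Prod>k\<in>{1..<b}. ?w (f k)) (\<lambda>f. H (f(b := y, 0 := x))))"
    using wavg_exists_le[OF finite_lessThan _ w1] by (metis (no_types, lifting) lessThan_iff of_nat_0_le_iff zero_le_divide_1_iff)
  ultimately have "wavg (PiE {1..<b} (\<lambda>_. ?B)) (\<lambda>f. \<Prod>k\<in>{1..<b}. ?w (f k)) (\<lambda>f. H (f(b := y, 0 := x))) \<le> real b * \<eta>"
    by linarith
  then have "real K ^ (b - 1) * wavg (PiE {1..<b} (\<lambda>_. ?B)) (\<lambda>f. \<Prod>k\<in>{1..<b}. ?w (f k)) (\<lambda>f. H (f(b := y, 0 := x)))
      \<le> real K ^ (b - 1) * (real b * \<eta>)"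
    by (rule mult_left_mono) simp
  moreover have "real K ^ (b - 1) * wavg (PiE {1..<b} (\<lambda>_. ?B)) (\<lambda>f. \<Prod>k\<in>{1..<b}. ?w (f k)) (\<lambda>f. H (f(b := y, 0 := x))) =
     (\<Sum>f\<in>PiE {1..<b} (\<lambda>_. ?B). H (f(b := y, 0 := x)))"
    using K by (simp add: wavg_def power_divide flip: sum_divide_distrib)
  ultimately show thesis
    using x(1) y(1) by (intro that[of x y]) (simp_all only: H_def)
qed

subsection \<open>Measure-and-prepare channels and product measurements\<close>

definition measure_prepare ::
  "'i set \<Rightarrow> 'm set \<Rightarrow> ('m \<Rightarrow> 'i oper) \<Rightarrow> ('m \<Rightarrow> 'j) \<Rightarrow> 'i oper \<Rightarrow> 'j oper" where
  "measure_prepare I M F y A = (\<lambda>i j. \<Sum>m\<in>M. op_trace I (op_mult I (F m) A) * ketbra (y m) i j)"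

lemma op_trace_mult_linear:
  "op_trace I (op_mult I A (\<lambda>i j. c * B i j + D i j)) =
   c * op_trace I (op_mult I A B) + op_trace I (op_mult I A D)"
  by (simp add: op_trace_mult distrib_left sum.distrib sum_distrib_left mult_ac)

lemma op_trace_mult_sum:
  "op_trace I (op_mult I (\<lambda>i j. \<Sum>m\<in>M. F m i j) A) = (\<Sum>m\<in>M. op_trace I (op_mult I (F m) A))"
  unfolding op_trace_mult sum_distrib_right by (rule sum_pull2)

lemma op_trace_mult_id:
  assumes "finite I"
  shows "op_trace I (op_mult I (id_op I) A) = op_trace I A"
proof -
  have "(\<Sum>j\<in>I. id_op I i j * A j i) = A i i" if "i \<in> I" for i
  proof -
    have "(\<Sum>j\<in>I. id_op I i j * A j i) = (\<Sum>j\<in>I. if j = i then A i i else 0)"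
      using that by (intro sum.cong) (auto simp: id_op_def)
    then show ?thesis using assms that by simp
  qed
  then show ?thesis by (simp add: op_trace_mult op_trace_def[of I A])
qed

text \<open>On an extended system the output is a sum of \<open>ketbra (y m)\<close> tensor the
  contraction of the input against \<open>F m\<close>, so complete positivity reduces to
  \<open>psd_contract\<close>. Trace preservation is completeness of the POVM.\<close>

lemma quantum_channel_measure_prepare:
  assumes fin: "finite I" "finite J" and povm: "povm I M F" and y: "\<And>m. m \<in> M \<Longrightarrow> y m \<in> J"
  shows "quantum_channel I J (measure_prepare I M F y)"
  unfolding quantum_channel_def
proof (intro conjI ballI allI impI)
  fix A assume "A \<in> operators I"
  have "measure_prepare I M F y A i j = 0" if "i \<notin> J \<or> j \<notin> J" for i j
    using y that unfolding measure_prepare_def by (intro sum.neutral) (auto simp: ketbra_def)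
  then show "measure_prepare I M F y A \<in> operators J"
    unfolding operators_def by blast
  show "op_trace J (measure_prepare I M F y A) = op_trace I A"
  proof -
    have "op_trace J (measure_prepare I M F y A) =
        (\<Sum>m\<in>M. \<Sum>j\<in>J. op_trace I (op_mult I (F m) A) * ketbra (y m) j j)"
      unfolding measure_prepare_def op_trace_def[of J] by (rule sum.swap)
    also have "\<dots> = (\<Sum>m\<in>M. op_trace I (op_mult I (F m) A))"
    proof (intro sum.cong refl)
      fix m assume "m \<in> M"
      then have "(\<Sum>j\<in>J. ketbra (y m) j j) = 1"
        using fin(2) y by (simp add: ketbra_def)
      then show "(\<Sum>j\<in>J. op_trace I (op_mult I (F m) A) * ketbra (y m) j j) = op_trace I (op_mult I (F m) A)"
        by (simp flip: sum_distrib_left)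
    qed
    also have "\<dots> = op_trace I (op_mult I (id_op I) A)"
      using povm unfolding povm_def op_trace_mult_sum[symmetric] by simp
    finally show ?thesis using op_trace_mult_id[OF fin(1)] by simp
  qed
next
  fix A B :: "'a oper" and c
  show "measure_prepare I M F y (\<lambda>i j. c * A i j + B i j) =
      (\<lambda>i j. c * measure_prepare I M F y A i j + measure_prepare I M F y B i j)"
    unfolding measure_prepare_def op_trace_mult_linear
    by (simp add: distrib_right sum.distrib sum_distrib_left mult.assoc)
next
  fix d :: nat and A :: "('a \<times> nat) oper"
  assume A: "psd (I \<times> {..<d}) A"
  have "psd (J \<times> {..<d}) (\<lambda>u v. \<Sum>m\<in>M. tensor (ketbra (y m)) (\<lambda>k l. \<Sum>s\<in>I. \<Sum>t\<in>I. F m s t * A (t, k) (s, l)) u v)"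
    using povm A fin y unfolding povm_def
    by (intro psd_sum psd_tensor psd_ketbra psd_contract) auto
  moreover have "map_tensor_id (measure_prepare I M F y) A =
      (\<lambda>u v. \<Sum>m\<in>M. tensor (ketbra (y m)) (\<lambda>k l. \<Sum>s\<in>I. \<Sum>t\<in>I. F m s t * A (t, k) (s, l)) u v)"
    by (simp add: fun_eq_iff map_tensor_id_def measure_prepare_def tensor_def op_trace_mult mult.commute)
  ultimately show "psd (J \<times> {..<d}) (map_tensor_id (measure_prepare I M F y) A)"
    by simp
qed (use fin in auto)

lemma measure_prepare_classical:
  assumes "\<And>m. m \<in> M \<Longrightarrow> fst (y m) = x2 m" and "x \<noteq> x'"
  shows "measure_prepare I M F y A (x, k) (x', k') = 0"
proof -
  have "ketbra (y m) (x, k) (x', k') = 0" if "m \<in> M" for m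
    using assms that by (metis fst_conv ketbra_def)
  then show ?thesis unfolding measure_prepare_def by (intro sum.neutral) auto
qed

section \<open>Product operators and product measurements on lists\<close>

lemma sum_lists_Suc:
  "(\<Sum>bs | length bs = Suc n. h bs) = (\<Sum>bs | length bs = n. \<Sum>x\<in>UNIV. h (bs @ [x :: 'b::finite]))"
proof -
  have eq: "{bs. length bs = Suc n} = (\<lambda>(bs, x). bs @ [x :: 'b]) ` ({bs. length bs = n} \<times> UNIV)"
    by (auto simp: image_iff length_Suc_conv_rev)
  show ?thesis
    unfolding eq by (subst sum.reindex) (auto simp: inj_on_def sum.cartesian_product' split_def)
qed

lemma finite_lists_length: "finite {bs :: 'b::finite list. length bs = n}"
  using finite_lists_length_eq[of "UNIV :: 'b set" n] by simp

definition ptensor :: "(nat \<Rightarrow> 'b oper) \<Rightarrow> nat \<Rightarrow> 'b list oper" where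
  "ptensor Q n = (\<lambda>bs bs'. if length bs = n \<and> length bs' = n then \<Prod>j<n. Q j (bs ! j) (bs' ! j) else 0)"

lemma ptensor_0: "ptensor Q 0 = (\<lambda>bs bs'. if bs = [] \<and> bs' = [] then 1 else 0)"
  by (simp add: ptensor_def fun_eq_iff)

lemma ptensor_snoc:
  assumes "length bs = n" "length bs' = n"
  shows "ptensor Q (Suc n) (bs @ [x]) (bs' @ [y]) = ptensor Q n bs bs' * Q n x y"
  using assms by (simp add: ptensor_def nth_append)

lemma ptensor_id: "ptensor (\<lambda>_. id_op UNIV) n = id_op {bs. length bs = n}"
proof (intro ext)
  fix bs bs' :: "'a list"
  show "ptensor (\<lambda>_. id_op UNIV) n bs bs' = id_op {bs. length bs = n} bs bs'"
  proof (cases "length bs = n \<and> length bs' = n \<and> bs \<noteq> bs'")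
    case True
    then obtain j where "j < n" "bs ! j \<noteq> bs' ! j" by (metis nth_equalityI)
    then have "(\<Prod>j<n. id_op UNIV (bs ! j) (bs' ! j)) = (0::complex)"
      by (intro prod_zero) (auto simp: id_op_def)
    then show ?thesis using True by (simp add: ptensor_def id_op_def)
  qed (auto simp: ptensor_def id_op_def)
qed

text \<open>The induction peels off the last label, matching the order in which the receiver
  collects its outputs.\<close>

lemma psd_ptensor:
  fixes Q :: "nat \<Rightarrow> 'b::finite oper"
  assumes "\<And>j. j < n \<Longrightarrow> psd UNIV (Q j)"
  shows "psd {bs. length bs = n} (ptensor Q n)"
  using assms
proof (induction n)
  case 0
  have "{bs. length bs = 0} = {[] :: 'b list}" by auto
  then show ?case by (auto simp: psd_def operators_def ptensor_0 complex_nonneg_Reals_iff)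
next
  case (Suc n)
  have "psd ({bs. length bs = n} \<times> UNIV) (tensor (ptensor Q n) (Q n))"
    using Suc by (intro psd_tensor finite_lists_length) auto
  moreover have "qform {bs. length bs = Suc n} (ptensor Q (Suc n)) v =
      qform ({bs. length bs = n} \<times> UNIV) (tensor (ptensor Q n) (Q n)) (\<lambda>(bs, x). v (bs @ [x]))" for v
    unfolding qform_Times qform_def[of "{bs. length bs = Suc n}"] sum_lists_Suc
    by (intro sum.cong refl) (simp add: ptensor_snoc tensor_def)
  moreover have "ptensor Q (Suc n) \<in> operators {bs. length bs = Suc n}"
    by (auto simp: operators_def ptensor_def split: if_splits)
  ultimately show ?case by (simp add: psd_iff_qform)
qed

text \<open>The output with index 0 is left unmeasured, since the relay then sends the fixed
  boundary message. Completeness comes from expanding the product of the sums over outcomes;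
  extensional functions count each tuple once.\<close>

lemma povm_ptensor:
  fixes Q :: "nat \<Rightarrow> 'b::finite oper"
  assumes Q: "povm UNIV {..<K} Q" and n: "n \<ge> 1"
  shows "povm {bs. length bs = n} (PiE {1..<n} (\<lambda>_. {..<K}))
    (\<lambda>f. ptensor (\<lambda>j. if j = 0 then id_op UNIV else Q (f j)) n)"
  unfolding povm_def
proof (intro conjI ballI ext)
  fix f assume "f \<in> PiE {1..<n} (\<lambda>_. {..<K})"
  then show "psd {bs. length bs = n} (ptensor (\<lambda>j. if j = 0 then id_op UNIV else Q (f j)) n)"
    using Q by (intro psd_ptensor) (auto simp: povm_def psd_id_op PiE_iff)
next
  fix bs bs' :: "'b list"
  have "(\<Sum>m<K. Q m x y) = id_op UNIV x y" for x y
    using Q by (metis povm_def)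
  moreover have "{..<n} = insert 0 {1..<n}" using n by auto
  then have *: "(\<Prod>j<n. h j) = h 0 * (\<Prod>j\<in>{1..<n}. h j)" for h :: "nat \<Rightarrow> complex" by simp
  ultimately have "(\<Sum>f\<in>PiE {1..<n} (\<lambda>_. {..<K}). \<Prod>j<n. (if j = 0 then id_op UNIV else Q (f j)) (bs ! j) (bs' ! j)) =
      (\<Prod>j<n. id_op UNIV (bs ! j) (bs' ! j))"
    using prod_sum_PiE[of "{1..<n}" "\<lambda>_. {..<K}" "\<lambda>j m. Q m (bs ! j) (bs' ! j)"]
    by (simp add: flip: sum_distrib_left)
  then show "(\<Sum>f\<in>PiE {1..<n} (\<lambda>_. {..<K}). ptensor (\<lambda>j. if j = 0 then id_op UNIV else Q (f j)) n bs bs') =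
      id_op {bs. length bs = n} bs bs'"
    unfolding ptensor_id[symmetric]
    by (cases "length bs = n \<and> length bs' = n") (auto simp: ptensor_def)
qed

text \<open>The relay's decoder depends on the previous estimate, which sits in the memory. The
  controlled measurement is the direct sum of the \<open>E k\<close>, one block per memory
  label.\<close>

lemma povm_tensor_memory:
  fixes E :: "nat \<Rightarrow> nat \<Rightarrow> 'b::finite oper"
  assumes "\<And>k. k < K \<Longrightarrow> povm UNIV M (E k)"
  shows "povm (range Some \<times> {..<K}) M (\<lambda>m (c, k) (c', k').
    if c \<noteq> None \<and> c' \<noteq> None \<and> k = k' \<and> k < K then E k m (the c) (the c') else 0)"
    (is "povm ?I M ?F")
  unfolding povm_def
proof (intro conjI ballI ext)
  fix m assume m: "m \<in> M"
  define emb where "emb k = (\<lambda>c c'. if c \<noteq> None \<and> c' \<noteq> None then E k m (the c) (the c') else 0)" for k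
  have "psd (range Some) (emb k)" if "k < K" for k
  proof -
    have "qform (range Some) (emb k) v = qform UNIV (E k m) (\<lambda>b. v (Some b))" for v
      by (simp add: qform_def sum.reindex emb_def)
    moreover have "psd UNIV (E k m)" using assms[OF that] m by (auto simp: povm_def)
    moreover have "emb k \<in> operators (range Some)" by (auto simp: operators_def emb_def split: if_splits)
    ultimately show ?thesis by (simp add: psd_iff_qform)
  qed
  then have "psd ?I (\<lambda>u v. \<Sum>k<K. tensor (emb k) (ketbra k) u v)"
    by (intro psd_sum psd_tensor psd_ketbra) auto
  moreover have "(\<Sum>k<K. tensor (emb k) (ketbra k) u v) = ?F m u v" for u v
  proof -
    obtain c k c' k' where uv: "u = (c, k)" "v = (c', k')" by fastforce
    have "(\<Sum>l<K. tensor (emb l) (ketbra l) u v) = (\<Sum>l<K. if l = k then if k = k' then emb k c c' else 0 else 0)"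
      unfolding uv by (intro sum.cong) (auto simp: tensor_def ketbra_def)
    then show ?thesis by (auto simp: uv emb_def)
  qed
  ultimately show "psd ?I (?F m)" by simp
next
  fix u v :: "'b option \<times> nat"
  obtain c k c' k' where uv: "u = (c, k)" "v = (c', k')" by fastforce
  have *: "(\<Sum>m\<in>M. E k m b b') = id_op UNIV b b'" if "k < K" for b b'
    using assms[OF that] by (metis povm_def)
  then show "(\<Sum>m\<in>M. ?F m u v) = id_op ?I u v"
  proof (cases "c \<noteq> None \<and> c' \<noteq> None \<and> k = k' \<and> k < K")
    case True
    then show ?thesis using * by (auto simp: uv id_op_def)
  next
    case False
    then have "?F m u v = 0" for m by (simp only: uv split_conv if_False)
    moreover have "id_op ?I u v = 0" using False by (auto simp: uv id_op_def)
    ultimately show ?thesis by simp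
  qed
qed

subsection \<open>The relay protocol\<close>

text \<open>With estimate \<open>k\<close> in memory the relay transmits \<open>x2 k\<close> and
  measures the next message with \<open>E k\<close>; \<open>m\<^sub>0\<close> is its estimate before
  the first block.\<close>

locale relay_protocol =
  fixes N :: "'x1::finite \<times> 'x2::finite \<Rightarrow> ('b2::finite \<times> 'b3::finite) oper"
    and K m\<^sub>0 :: nat and x2 :: "nat \<Rightarrow> 'x2" and E :: "nat \<Rightarrow> nat \<Rightarrow> 'b2 oper"
  assumes N: "cq_relay_channel N" and m0: "m\<^sub>0 < K"
    and E: "\<And>k. k < K \<Longrightarrow> povm UNIV {..<K} (E k)"
begin

text \<open>The first operation acts on the trivial system and prepares \<open>m\<^sub>0\<close>.
  Each later one decodes the preceding block and writes its result twice, as channel input and as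
  new memory.\<close>

definition relay :: "nat \<Rightarrow> ('b2 option \<times> nat) oper \<Rightarrow> ('x2 \<times> nat) oper" where
  "relay j = (if j \<le> 1
     then measure_prepare {(None, 0)} {m\<^sub>0} (\<lambda>_. id_op {(None, 0)}) (\<lambda>m. (x2 m, m))
     else measure_prepare (range Some \<times> {..<K}) {..<K}
       (\<lambda>m (c, k) (c', k').
          if c \<noteq> None \<and> c' \<noteq> None \<and> k = k' \<and> k < K then E k m (the c) (the c') else 0)
       (\<lambda>m. (x2 m, m)))"

text \<open>The unnormalised state of the receiver's output in one block, jointly with the relay
  passing from estimate \<open>k\<close> to \<open>k'\<close>: a partial trace over the relay's
  output against its measurement operator.\<close>

definition transition :: "'x1 \<Rightarrow> nat \<Rightarrow> nat \<Rightarrow> 'b3 oper" where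
  "transition x k k' = (\<lambda>\<beta> \<beta>'. \<Sum>c\<in>UNIV. \<Sum>c'\<in>UNIV. E k k' c c' * N (x, x2 k) (c', \<beta>) (c, \<beta>'))"

text \<open>The unnormalised state of the receiver after \<open>j\<close> blocks, jointly with the event that the
  classical estimate that the relay forms from block \<open>j\<close> is \<open>k\<close>.\<close>

primrec output_state :: "(nat \<Rightarrow> 'x1) \<Rightarrow> nat \<Rightarrow> nat \<Rightarrow> 'b3 list oper" where
  "output_state xs 0 k = (\<lambda>bs bs'. if k = m\<^sub>0 \<and> bs = [] \<and> bs' = [] then 1 else 0)"
| "output_state xs (Suc j) k = (\<lambda>bs bs'. if bs = [] \<or> bs' = [] then 0
     else \<Sum>l<K. output_state xs j l (butlast bs) (butlast bs') *
       transition (xs j) l k (last bs) (last bs'))"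

lemma prepare_codeword:
  "(\<Sum>m\<in>M. h m * ketbra (x2 m, m) (x, k) (x', k')) =
    (if finite M \<and> k \<in> M \<and> x = x2 k \<and> x' = x2 k \<and> k = k' then h k else 0)"
proof -
  have "(\<Sum>m\<in>M. h m * ketbra (x2 m, m) (x, k) (x', k')) =
      (\<Sum>m\<in>M. if m = k then if x = x2 k \<and> x' = x2 k \<and> k = k' then h k else 0 else 0)"
    by (intro sum.cong) (auto simp: ketbra_def)
  then show ?thesis by (cases "finite M") auto
qed

lemma relay_output_0:
  "map_tensor_id (relay (Suc 0)) (ketbra ((None, 0), [])) ((x, k), bs) ((x', k'), bs') =
    (if x = x2 k \<and> x' = x2 k \<and> k = k' \<and> k < K then output_state xs 0 k bs bs' else 0)"
  using m0 by (auto simp: map_tensor_id_def relay_def measure_prepare_def prepare_codeword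
      op_trace_mult id_op_def ketbra_def)

lemma channel_use_relay_output:
  assumes "\<And>x k bs x' k' bs'. \<sigma> ((x, k), bs) ((x', k'), bs') =
    (if x = x2 k \<and> x' = x2 k \<and> k = k' \<and> k < K then g k bs bs' else 0)"
  shows "channel_use N x \<sigma> ((c, k), bs) ((c', k'), bs') =
    (if c = None \<or> c' = None \<or> bs = [] \<or> bs' = [] \<or> k \<noteq> k' \<or> \<not> k < K then 0
     else g k (butlast bs) (butlast bs') * N (x, x2 k) (the c, last bs) (the c', last bs'))"
proof (cases "c = None \<or> c' = None \<or> bs = [] \<or> bs' = []")
  case False
  have "(\<Sum>z\<in>UNIV. \<sigma> ((z, k), butlast bs) ((z, k'), butlast bs') *
            N (x, z) (the c, last bs) (the c', last bs')) =
     (\<Sum>z\<in>UNIV. if z = x2 k then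
        if k = k' \<and> k < K then g k (butlast bs) (butlast bs') * N (x, x2 k) (the c, last bs) (the c', last bs')
        else 0 else 0)"
    by (intro sum.cong refl) (simp add: assms)
  then show ?thesis using False by (auto simp: channel_use_def)
qed (auto simp: channel_use_def)

lemma relay_output_Suc:
  assumes J: "\<And>c k bs c' k' bs'. J ((c, k), bs) ((c', k'), bs') =
    (if c = None \<or> c' = None \<or> bs = [] \<or> bs' = [] \<or> k \<noteq> k' \<or> \<not> k < K then 0
     else output_state xs j k (butlast bs) (butlast bs') *
       N (xs j, x2 k) (the c, last bs) (the c', last bs'))"
  shows "map_tensor_id (relay (Suc (Suc j))) J ((x, k), bs) ((x', k'), bs') =
    (if x = x2 k \<and> x' = x2 k \<and> k = k' \<and> k < K then output_state xs (Suc j) k bs bs' else 0)"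
proof -
  let ?I = "range Some \<times> {..<K} :: ('b2 option \<times> nat) set"
  let ?F = "\<lambda>m (c, k) (c', k').
    if c \<noteq> None \<and> c' \<noteq> None \<and> k = k' \<and> k < K then E k m (the c) (the c') else 0"
  have "op_trace ?I (op_mult ?I (?F m) (\<lambda>s t. J (s, bs) (t, bs'))) = output_state xs (Suc j) m bs bs'" for m
  proof -
    have "op_trace ?I (op_mult ?I (?F m) (\<lambda>s t. J (s, bs) (t, bs'))) =
      (\<Sum>c\<in>UNIV. \<Sum>l<K. \<Sum>c'\<in>UNIV. \<Sum>l'<K. if l' = l then E l m c c' * J ((Some c', l), bs) ((Some c, l), bs') else 0)"
      unfolding op_trace_mult sum.cartesian_product' sum.reindex[OF inj_Some] o_def
      by (intro sum.cong refl) auto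
    also have "\<dots> = (\<Sum>c\<in>UNIV. \<Sum>l<K. \<Sum>c'\<in>UNIV. E l m c c' * J ((Some c', l), bs) ((Some c, l), bs'))"
      by (intro sum.cong refl) simp
    also have "\<dots> = (\<Sum>l<K. \<Sum>c\<in>UNIV. \<Sum>c'\<in>UNIV. E l m c c' * J ((Some c', l), bs) ((Some c, l), bs'))"
      by (rule sum.swap)
    also have "\<dots> = output_state xs (Suc j) m bs bs'"
    proof (cases "bs = [] \<or> bs' = []")
      case False
      then have "output_state xs (Suc j) m bs bs' = (\<Sum>l<K. \<Sum>c\<in>UNIV. \<Sum>c'\<in>UNIV.
          output_state xs j l (butlast bs) (butlast bs') *
          (E l m c c' * N (xs j, x2 l) (c', last bs) (c, last bs')))"
        by (simp add: transition_def sum_distrib_left)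
      also have "\<dots> = (\<Sum>l<K. \<Sum>c\<in>UNIV. \<Sum>c'\<in>UNIV. E l m c c' * J ((Some c', l), bs) ((Some c, l), bs'))"
        by (intro sum.cong refl) (use False in \<open>simp add: J mult_ac\<close>)
      finally show ?thesis by simp
    qed (auto simp: J)
    finally show ?thesis .
  qed
  then show ?thesis
    by (simp add: map_tensor_id_def relay_def measure_prepare_def prepare_codeword del: output_state.simps)
qed

text \<open>The invariant of the protocol: the state stays diagonal in the memory. It involves
  \<open>output_state\<close> with index \<open>j\<close> although \<open>j + 1\<close> blocks have
  passed, because the relay has not yet measured its output of the last block.\<close>

lemma joint_state_Suc:
  assumes "relay_op C = relay"
  shows "joint_state N C m (Suc j) ((c, k), bs) ((c', k'), bs') =
    (if c = None \<or> c' = None \<or> bs = [] \<or> bs' = [] \<or> k \<noteq> k' \<or> \<not> k < K then 0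
     else output_state ((!) (enc C m)) j k (butlast bs) (butlast bs') *
       N (enc C m ! j, x2 k) (the c, last bs) (the c', last bs'))"
proof (induction j arbitrary: c k bs c' k' bs')
  case 0
  show ?case
    unfolding joint_state.simps assms
    by (rule channel_use_relay_output) (rule relay_output_0)
next
  case (Suc j)
  show ?case
    unfolding joint_state.simps(2)[of _ _ _ "Suc j"] assms
    by (rule channel_use_relay_output, rule relay_output_Suc, rule Suc)
qed

lemma sum_E: "l < K \<Longrightarrow> (\<Sum>k<K. E l k c c') = id_op UNIV c c'"
  using E[of l] by (metis povm_def)

text \<open>After the last block the relay does not act any more. Tracing out its system equals
  summing over the outcomes of one further measurement, by completeness of
  \<open>E l\<close>.\<close>

lemma receiver_state_output_state:
  assumes C: "relay_op C = relay" "mem_dim C = (\<lambda>j. if j = 0 then 1 else K)" and n: "n \<ge> 1"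
  shows "receiver_state N C n m = (\<lambda>bs bs'. \<Sum>k<K. output_state ((!) (enc C m)) n k bs bs')"
proof (intro ext)
  fix bs bs'
  obtain j where j: "n = Suc j" using n by (cases n) auto
  let ?xs = "(!) (enc C m)"
  have labels: "relay_labels C n = range Some \<times> {..<K}"
    using j C by (simp add: relay_labels_def)
  have "receiver_state N C n m bs bs' =
      (\<Sum>c\<in>UNIV. \<Sum>k<K. joint_state N C m (Suc j) ((Some c, k), bs) ((Some c, k), bs'))"
    unfolding receiver_state_def labels unfolding j sum.cartesian_product' sum.reindex[OF inj_Some] o_def ..
  also have "\<dots> = (\<Sum>k<K. output_state ?xs n k bs bs')"
  proof (cases "bs = [] \<or> bs' = []")
    case False
    have "(\<Sum>k<K. output_state ?xs n k bs bs') =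
        (\<Sum>l<K. output_state ?xs j l (butlast bs) (butlast bs') * (\<Sum>k<K. transition (?xs j) l k (last bs) (last bs')))"
      using False unfolding j by (simp add: sum_distrib_left) (rule sum.swap)
    also have "\<dots> = (\<Sum>l<K. output_state ?xs j l (butlast bs) (butlast bs') *
        (\<Sum>c\<in>UNIV. N (?xs j, x2 l) (c, last bs) (c, last bs')))"
    proof (intro sum.cong refl arg_cong2[of _ _ _ _ "(*)"])
      fix l assume "l \<in> {..<K}"
      then have l: "l < K" by simp
      have "(\<Sum>k<K. transition (?xs j) l k (last bs) (last bs')) =
          (\<Sum>c\<in>UNIV. \<Sum>c'\<in>UNIV. (\<Sum>k<K. E l k c c') * N (?xs j, x2 l) (c', last bs) (c, last bs'))"
        unfolding transition_def sum_distrib_right by (rule sum_pull2[symmetric])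
      also have "\<dots> = (\<Sum>c\<in>UNIV. \<Sum>c'\<in>UNIV. if c' = c then N (?xs j, x2 l) (c, last bs) (c, last bs') else 0)"
        unfolding sum_E[OF l] by (intro sum.cong refl) (auto simp: id_op_def)
      finally show "(\<Sum>k<K. transition (?xs j) l k (last bs) (last bs')) =
          (\<Sum>c\<in>UNIV. N (?xs j, x2 l) (c, last bs) (c, last bs'))" by simp
    qed
    also have "\<dots> = (\<Sum>k<K. \<Sum>c\<in>UNIV. joint_state N C m (Suc j) ((Some c, k), bs) ((Some c, k), bs'))"
      unfolding sum_distrib_left joint_state_Suc[OF C(1)] using False by (intro sum.cong refl) auto
    also have "\<dots> = (\<Sum>c\<in>UNIV. \<Sum>k<K. joint_state N C m (Suc j) ((Some c, k), bs) ((Some c, k), bs'))"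
      by (rule sum.swap)
    finally show ?thesis by simp
  qed (auto simp: j joint_state_Suc[OF C(1)] simp del: joint_state.simps)
  finally show "receiver_state N C n m bs bs' = (\<Sum>k<K. output_state ?xs n k bs bs')" .
qed

section \<open>Block probabilities and paths of relay estimates\<close>

definition block_prob :: "'b3 oper \<Rightarrow> 'x1 \<Rightarrow> nat \<Rightarrow> nat \<Rightarrow> complex" where
  "block_prob Q x k k' = op_trace UNIV (op_mult UNIV (tensor (E k k') Q) (N (x, x2 k)))"

lemma block_prob_transition:
  "block_prob Q x k k' = (\<Sum>\<beta>\<in>UNIV. \<Sum>\<beta>'\<in>UNIV. Q \<beta> \<beta>' * transition x k k' \<beta>' \<beta>)"
proof -
  have "block_prob Q x k k' = (\<Sum>c\<in>UNIV. \<Sum>\<beta>\<in>UNIV. \<Sum>c'\<in>UNIV. \<Sum>\<beta>'\<in>UNIV.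
      E k k' c c' * Q \<beta> \<beta>' * N (x, x2 k) (c', \<beta>') (c, \<beta>))"
    unfolding block_prob_def op_trace_mult UNIV_Times_UNIV[symmetric] sum.cartesian_product'
    by (simp add: tensor_def)
  also have "\<dots> = (\<Sum>\<beta>\<in>UNIV. \<Sum>c\<in>UNIV. \<Sum>\<beta>'\<in>UNIV. \<Sum>c'\<in>UNIV.
      E k k' c c' * Q \<beta> \<beta>' * N (x, x2 k) (c', \<beta>') (c, \<beta>))"
    by (subst sum.swap) (intro sum.cong refl sum.swap)
  also have "\<dots> = (\<Sum>\<beta>\<in>UNIV. \<Sum>\<beta>'\<in>UNIV. \<Sum>c\<in>UNIV. \<Sum>c'\<in>UNIV.
      E k k' c c' * Q \<beta> \<beta>' * N (x, x2 k) (c', \<beta>') (c, \<beta>))"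
    by (intro sum.cong refl sum.swap)
  finally show ?thesis
    by (simp add: transition_def sum_distrib_left mult_ac)
qed

definition path_prob :: "(nat \<Rightarrow> 'b3 oper) \<Rightarrow> (nat \<Rightarrow> 'x1) \<Rightarrow> nat \<Rightarrow> nat \<Rightarrow> complex" where
  "path_prob Q xs j k = op_trace {bs. length bs = j} (op_mult {bs. length bs = j} (ptensor Q j) (output_state xs j k))"

lemma path_prob_0: "path_prob Q xs 0 k = (if k = m\<^sub>0 then 1 else 0)"
proof -
  have "{bs. length bs = 0} = {[] :: 'b3 list}" by auto
  then show ?thesis by (simp add: path_prob_def op_trace_mult ptensor_0)
qed

text \<open>Between blocks only the classical estimate survives at the relay, so under product
  effects at the receiver the estimates follow a Markov recursion with kernel
  \<open>block_prob\<close>.\<close>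

lemma path_prob_Suc:
  "path_prob Q xs (Suc j) k = (\<Sum>l<K. path_prob Q xs j l * block_prob (Q j) (xs j) l k)"
proof -
  let ?L = "{bs :: 'b3 list. length bs = j}"
  have "path_prob Q xs (Suc j) k = (\<Sum>bs\<in>?L. \<Sum>\<beta>\<in>UNIV. \<Sum>bs'\<in>?L. \<Sum>\<beta>'\<in>UNIV. \<Sum>l<K.
      ptensor Q j bs bs' * output_state xs j l bs' bs * (Q j \<beta> \<beta>' * transition (xs j) l k \<beta>' \<beta>))"
    unfolding path_prob_def op_trace_mult sum_lists_Suc
    by (intro sum.cong refl) (simp add: ptensor_snoc sum_distrib_left mult_ac)
  also have "\<dots> = (\<Sum>bs\<in>?L. \<Sum>bs'\<in>?L. \<Sum>\<beta>\<in>UNIV. \<Sum>\<beta>'\<in>UNIV. \<Sum>l<K.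
      ptensor Q j bs bs' * output_state xs j l bs' bs * (Q j \<beta> \<beta>' * transition (xs j) l k \<beta>' \<beta>))"
    by (intro sum.cong refl sum.swap)
  also have "\<dots> = (\<Sum>bs\<in>?L. \<Sum>bs'\<in>?L. \<Sum>l<K. \<Sum>\<beta>\<in>UNIV. \<Sum>\<beta>'\<in>UNIV.
      ptensor Q j bs bs' * output_state xs j l bs' bs * (Q j \<beta> \<beta>' * transition (xs j) l k \<beta>' \<beta>))"
    by (intro sum.cong refl sum_pull2)
  also have "\<dots> = (\<Sum>l<K. \<Sum>bs\<in>?L. \<Sum>bs'\<in>?L. \<Sum>\<beta>\<in>UNIV. \<Sum>\<beta>'\<in>UNIV.
      ptensor Q j bs bs' * output_state xs j l bs' bs * (Q j \<beta> \<beta>' * transition (xs j) l k \<beta>' \<beta>))"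
    by (rule sum_pull2)
  also have "\<dots> = (\<Sum>l<K. path_prob Q xs j l * block_prob (Q j) (xs j) l k)"
    unfolding path_prob_def op_trace_mult block_prob_transition sum_distrib_right
    unfolding sum_distrib_left ..
  finally show ?thesis .
qed

lemma psd_N: "psd UNIV (N z)" and trace_N: "op_trace UNIV (N z) = 1"
  using N unfolding cq_relay_channel_def state_def by blast+

lemma psd_E: "l < K \<Longrightarrow> k < K \<Longrightarrow> psd UNIV (E l k)"
  using E by (auto simp: povm_def)

lemma block_prob_nonneg:
  assumes "psd UNIV Q" "l < K" "k < K"
  shows "block_prob Q x l k \<in> \<real>\<^sub>\<ge>\<^sub>0"
  unfolding block_prob_def using psd_tensor[of UNIV "E l k" UNIV Q] psd_E assms psd_N
  by (intro psd_trace_mult_nonneg) auto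

lemma path_prob_nonneg:
  assumes "\<And>j. psd UNIV (Q j)" "k < K"
  shows "path_prob Q xs j k \<in> \<real>\<^sub>\<ge>\<^sub>0"
  using assms(2)
proof (induction j arbitrary: k)
  case (Suc j)
  then show ?case
    unfolding path_prob_Suc using assms(1)
    by (auto intro!: nonneg_Reals_sum nonneg_Reals_mult_I block_prob_nonneg)
qed (simp add: path_prob_0)

text \<open>All terms of the recursion are nonnegative, so only the intended path
  \<open>\<mu>\<close> is kept.\<close>

lemma path_prob_ge:
  assumes Q: "\<And>j. psd UNIV (Q j)" and \<mu>: "\<mu> 0 = m\<^sub>0" "\<And>j. j \<le> n \<Longrightarrow> \<mu> j < K"
  shows "Re (path_prob Q xs n (\<mu> n)) \<ge> (\<Prod>j<n. Re (block_prob (Q j) (xs j) (\<mu> j) (\<mu> (Suc j))))"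
  using \<mu>(2)
proof (induction n)
  case (Suc n)
  have nn: "path_prob Q xs n l \<in> \<real>\<^sub>\<ge>\<^sub>0" "block_prob (Q n) (xs n) l (\<mu> (Suc n)) \<in> \<real>\<^sub>\<ge>\<^sub>0" if "l < K" for l
    using that Q Suc.prems[of "Suc n"] by (auto intro: path_prob_nonneg block_prob_nonneg)
  have "(\<Prod>j<Suc n. Re (block_prob (Q j) (xs j) (\<mu> j) (\<mu> (Suc j))))
     \<le> Re (path_prob Q xs n (\<mu> n)) * Re (block_prob (Q n) (xs n) (\<mu> n) (\<mu> (Suc n)))"
    using Suc nn(2)[of "\<mu> n"] by (auto simp: complex_nonneg_Reals_iff intro!: mult_right_mono)
  also have "\<dots> = Re (path_prob Q xs n (\<mu> n) * block_prob (Q n) (xs n) (\<mu> n) (\<mu> (Suc n)))"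
    using nn[of "\<mu> n"] Suc.prems[of n] by (auto simp: complex_nonneg_Reals_iff)
  also have "\<dots> \<le> (\<Sum>l<K. Re (path_prob Q xs n l * block_prob (Q n) (xs n) l (\<mu> (Suc n))))"
    using nn Suc.prems[of n] by (intro member_le_sum) (auto simp: complex_nonneg_Reals_iff)
  finally show ?case by (simp add: path_prob_Suc)
qed (simp add: path_prob_0 \<mu>(1))

lemma sum_block_prob_id:
  assumes "l < K"
  shows "(\<Sum>k<K. block_prob (id_op UNIV) x l k) = 1"
proof -
  have "(\<Sum>k<K. block_prob (id_op UNIV) x l k) = op_trace UNIV (op_mult UNIV
      (\<lambda>u v. \<Sum>k<K. tensor (E l k) (id_op UNIV) u v) (N (x, x2 l)))"
    unfolding block_prob_def op_trace_mult_sum ..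
  also have "(\<lambda>u v. \<Sum>k<K. tensor (E l k) (id_op UNIV) u v) = id_op (UNIV :: ('b2 \<times> 'b3) set)"
  proof (intro ext)
    fix u v :: "'b2 \<times> 'b3"
    have "(\<Sum>k<K. tensor (E l k) (id_op UNIV) u v) =
        (\<Sum>k<K. E l k (fst u) (fst v)) * id_op UNIV (snd u) (snd v)"
      by (simp add: tensor_def split_def sum_distrib_right)
    then show "(\<Sum>k<K. tensor (E l k) (id_op UNIV) u v) = id_op UNIV u v"
      by (simp add: sum_E[OF assms] id_op_def prod_eq_iff)
  qed
  finally show ?thesis by (simp add: op_trace_mult_id trace_N)
qed

lemma sum_path_prob_id: "(\<Sum>k<K. path_prob (\<lambda>_. id_op UNIV) xs j k) = 1"
proof (induction j)
  case 0
  then show ?case using m0 by (simp add: path_prob_0)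
next
  case (Suc j)
  have "(\<Sum>k<K. path_prob (\<lambda>_. id_op UNIV) xs (Suc j) k) =
      (\<Sum>l<K. path_prob (\<lambda>_. id_op UNIV) xs j l * (\<Sum>k<K. block_prob (id_op UNIV) (xs j) l k))"
    unfolding path_prob_Suc sum_distrib_left by (rule sum.swap)
  then show ?case using Suc by (simp add: sum_block_prob_id)
qed

text \<open>The total path weight is 1 under the identity, so the error is 1 minus the total path
  weight under \<open>Q\<close>. Of the latter only the intended path is retained, on which every
  relay estimate is correct.\<close>

lemma decoding_error_le:
  assumes C: "relay_op C = relay" "mem_dim C = (\<lambda>j. if j = 0 then 1 else K)" and n: "n \<ge> 1"
    and Q: "\<And>j. psd UNIV (Q j)" and \<mu>: "\<mu> 0 = m\<^sub>0" "\<And>j. j \<le> n \<Longrightarrow> \<mu> j < K"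
  shows "Re (op_trace {bs. length bs = n} (op_mult {bs. length bs = n}
      (op_diff (id_op {bs. length bs = n}) (ptensor Q n)) (receiver_state N C n m)))
    \<le> 1 - (\<Prod>j<n. Re (block_prob (Q j) (enc C m ! j) (\<mu> j) (\<mu> (Suc j))))"
proof -
  let ?L = "{bs :: 'b3 list. length bs = n}"
  let ?xs = "(!) (enc C m)"
  have tr: "op_trace ?L (op_mult ?L (ptensor Q' n) (receiver_state N C n m)) = (\<Sum>k<K. path_prob Q' ?xs n k)" for Q'
    unfolding receiver_state_output_state[OF C n] path_prob_def op_trace_mult sum_distrib_left
    by (rule sum_pull2)
  have "op_trace ?L (op_mult ?L (op_diff (id_op ?L) (ptensor Q n)) (receiver_state N C n m)) =
      1 - (\<Sum>k<K. path_prob Q ?xs n k)"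
    unfolding ptensor_id[symmetric] sum_path_prob_id[of ?xs n, symmetric] tr[symmetric]
    by (simp add: op_trace_mult op_diff_def left_diff_distrib sum_subtractf)
  moreover have "Re (path_prob Q ?xs n (\<mu> n)) \<le> (\<Sum>k<K. Re (path_prob Q ?xs n k))"
    using path_prob_nonneg[OF Q] \<mu>(2)[of n] by (intro member_le_sum) (auto simp: complex_nonneg_Reals_iff)
  ultimately show ?thesis
    using path_prob_ge[of Q \<mu> n ?xs, OF Q \<mu>] by simp
qed

lemma quantum_channel_relay:
  assumes C: "mem_dim C = (\<lambda>j. if j = 0 then 1 else K)" and j: "j \<ge> 1"
  shows "quantum_channel (relay_labels C (j - 1)) (UNIV \<times> {..<mem_dim C j}) (relay j)"
    and "x \<noteq> x' \<Longrightarrow> relay j A (x, k) (x', k') = 0"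
proof -
  have dim: "mem_dim C j = K" using C j by simp
  show "quantum_channel (relay_labels C (j - 1)) (UNIV \<times> {..<mem_dim C j}) (relay j)"
  proof (cases "j = 1")
    case True
    have labels: "relay_labels C (j - 1) = {(None, 0)}" by (auto simp: relay_labels_def C True)
    have "povm {(None, 0)} {m\<^sub>0} (\<lambda>_. id_op {(None, 0)} :: ('b2 option \<times> nat) oper)"
      using psd_id_op[of "{(None, 0)} :: ('b2 option \<times> nat) set"] by (simp add: povm_def)
    then have "quantum_channel {(None, 0)} (UNIV \<times> {..<K})
        (measure_prepare {(None, 0)} {m\<^sub>0} (\<lambda>_. id_op {(None, 0)}) (\<lambda>m. (x2 m, m)) ::
          ('b2 option \<times> nat) oper \<Rightarrow> _)"
      by (rule quantum_channel_measure_prepare[rotated 2]) (use m0 in auto)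
    then show ?thesis
      unfolding relay_def labels dim using True by (simp only: if_True order_refl)
  next
    case False
    then have labels: "relay_labels C (j - 1) = range Some \<times> {..<K}" and "\<not> j \<le> 1"
      using j by (simp_all add: relay_labels_def C)
    have "quantum_channel (range Some \<times> {..<K}) (UNIV \<times> {..<K})
      (measure_prepare (range Some \<times> {..<K}) {..<K}
       (\<lambda>m (c, k) (c', k').
          if c \<noteq> None \<and> c' \<noteq> None \<and> k = k' \<and> k < K then E k m (the c) (the c') else 0)
       (\<lambda>m. (x2 m, m)))"
      by (rule quantum_channel_measure_prepare[OF _ _ povm_tensor_memory[OF E]]) auto
    then show ?thesis
      unfolding relay_def labels dim using \<open>\<not> j \<le> 1\<close> by (simp only: if_False)
  qed
  show "relay j A (x, k) (x', k') = 0" if "x \<noteq> x'"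
  proof (cases "j \<le> 1")
    case True
    then show ?thesis
      unfolding relay_def by (simp only: if_True, intro measure_prepare_classical[where ?x2.0 = x2 and x = x] that) simp
  next
    case False
    then show ?thesis
      unfolding relay_def by (simp only: if_False, intro measure_prepare_classical[where ?x2.0 = x2 and x = x] that) simp
  qed
qed

end

subsection \<open>Expectation values and hypothesis tests\<close>

definition expval :: "'i::finite oper \<Rightarrow> 'i oper \<Rightarrow> real" where
  "expval A \<sigma> = Re (op_trace UNIV (op_mult UNIV A \<sigma>))"

lemma expval_nonneg:
  assumes "psd UNIV A" "psd UNIV \<sigma>"
  shows "0 \<le> expval A \<sigma>"
  using psd_trace_mult_nonneg[OF finite assms] by (simp add: expval_def complex_nonneg_Reals_iff)

lemma expval_id: "op_trace UNIV \<sigma> = 1 \<Longrightarrow> expval (id_op UNIV) \<sigma> = 1"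
  by (simp add: expval_def op_trace_mult_id)

lemma expval_linear:
  "expval (\<lambda>i j. A i j + B i j) \<sigma> = expval A \<sigma> + expval B \<sigma>"
  "expval (\<lambda>i j. A i j - B i j) \<sigma> = expval A \<sigma> - expval B \<sigma>"
  "expval (\<lambda>i j. numeral n * A i j) \<sigma> = numeral n * expval A \<sigma>"
  "expval (\<lambda>i j. \<Sum>x\<in>X. F x i j) \<sigma> = (\<Sum>x\<in>X. expval (F x) \<sigma>)"
proof -
  show "expval (\<lambda>i j. numeral n * A i j) \<sigma> = numeral n * expval A \<sigma>"
    by (simp add: expval_def op_trace_mult mult.assoc flip: sum_distrib_left)
qed (simp_all add: expval_def op_trace_mult_sum op_trace_mult distrib_right left_diff_distrib sum.distrib sum_subtractf)

lemma expval_mixture: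
  "expval A (\<lambda>i j. \<Sum>t\<in>T. of_real (w t) * \<sigma> t i j) = wavg T w (\<lambda>t. expval A (\<sigma> t))"
proof -
  have "op_trace UNIV (op_mult UNIV A (\<lambda>i j. \<Sum>t\<in>T. of_real (w t) * \<sigma> t i j)) =
     (\<Sum>i\<in>UNIV. \<Sum>j\<in>UNIV. \<Sum>t\<in>T. of_real (w t) * (A i j * \<sigma> t j i))"
    by (simp add: op_trace_mult sum_distrib_left mult_ac)
  also have "\<dots> = (\<Sum>t\<in>T. of_real (w t) * op_trace UNIV (op_mult UNIV A (\<sigma> t)))"
    unfolding op_trace_mult sum_distrib_left by (rule sum_pull2)
  finally show ?thesis by (simp add: expval_def wavg_def)
qed

lemma state_mixture:
  assumes "\<And>t. t \<in> T \<Longrightarrow> state UNIV (\<sigma> t)" "\<And>t. t \<in> T \<Longrightarrow> w t \<ge> 0" "sum w T = 1"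
  shows "state UNIV (\<lambda>i j. \<Sum>t\<in>T. of_real (w t) * (\<sigma> t :: 'i::finite oper) i j)"
proof -
  have "psd UNIV (\<lambda>i j. \<Sum>t\<in>T. of_real (w t) * \<sigma> t i j)"
    using assms by (intro psd_sum psd_scale) (auto simp: state_def)
  moreover have "op_trace UNIV (\<lambda>i j. \<Sum>t\<in>T. of_real (w t) * \<sigma> t i j) = (\<Sum>t\<in>T. of_real (w t) * op_trace UNIV (\<sigma> t))"
    unfolding op_trace_def sum_distrib_left by (rule sum.swap)
  moreover have "(\<Sum>t\<in>T. complex_of_real (w t) * op_trace UNIV (\<sigma> t)) = (\<Sum>t\<in>T. complex_of_real (w t))"
    using assms(1) by (intro sum.cong) (auto simp: state_def)
  ultimately show ?thesis using assms(3) by (simp add: state_def flip: of_real_sum)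
qed

lemma sequential_decoder_state:
  fixes P :: "nat \<Rightarrow> 'i::finite oper"
  assumes P: "\<And>m. m < K \<Longrightarrow> test (P m)" and K: "K \<ge> 1"
  obtains E where "povm UNIV {..<K} E"
    and "\<And>m \<sigma>. m < K \<Longrightarrow> state UNIV \<sigma> \<Longrightarrow>
      1 - expval (E m) \<sigma> \<le> 4 * (1 - expval (P m) \<sigma>) + 4 * (\<Sum>l\<in>{..<K}-{m}. expval (P l) \<sigma>)"
proof -
  obtain E where E: "povm UNIV {..<K} E"
    "\<And>m. m < K \<Longrightarrow> psd UNIV (\<lambda>i j. 4 * (id_op UNIV i j - P m i j)
      + 4 * (\<Sum>m'\<in>{..<K}-{m}. P m' i j) - (id_op UNIV i j - E m i j))"
    using sequential_decoder[of K P, OF P K] by blast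
  show thesis
  proof (rule that[OF E(1)])
    fix m and \<sigma> :: "'i oper" assume "m < K" and \<sigma>: "state UNIV \<sigma>"
    then have "0 \<le> expval (\<lambda>i j. 4 * (id_op UNIV i j - P m i j)
      + 4 * (\<Sum>m'\<in>{..<K}-{m}. P m' i j) - (id_op UNIV i j - E m i j)) \<sigma>"
      using E(2) by (intro expval_nonneg) (auto simp: state_def)
    then show "1 - expval (E m) \<sigma> \<le> 4 * (1 - expval (P m) \<sigma>) + 4 * (\<Sum>l\<in>{..<K}-{m}. expval (P l) \<sigma>)"
      unfolding expval_linear using expval_id[of \<sigma>] \<sigma> by (simp add: state_def)
  qed
qed

lemma povm_test:
  assumes "povm UNIV M E" "finite M" "m \<in> M"
  shows "test (E m)"
proof -
  have "id_op UNIV i j = (\<Sum>m\<in>M. E m i j)" for i j using assms(1) by (metis povm_def)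
  then have "op_diff (id_op UNIV) (E m) = (\<lambda>i j. \<Sum>l\<in>M-{m}. E l i j)"
    by (simp add: op_diff_def fun_eq_iff sum.remove[OF assms(2,3)])
  moreover have "psd UNIV (\<lambda>i j. \<Sum>l\<in>M-{m}. E l i j)"
    using assms by (intro psd_sum) (auto simp: povm_def)
  ultimately show ?thesis using assms by (auto simp: test_def povm_def)
qed

text \<open>The test that acts on the quantum part once the classical register reads
  \<open>x\<close>.\<close>

definition slice :: "('x \<times> 'b) oper \<Rightarrow> 'x \<Rightarrow> 'b oper" where
  "slice P x = (\<lambda>b b'. P (x, b) (x, b'))"

lemma psd_slice:
  fixes P :: "('x::finite \<times> 'b::finite) oper"
  assumes "psd UNIV P"
  shows "psd UNIV (slice P x)"
proof -
  have "(\<Sum>s\<in>UNIV. \<Sum>t\<in>UNIV. ketbra x s t * P (t, k) (s, l)) = slice P x k l" for k l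
  proof -
    have "(\<Sum>t\<in>UNIV. ketbra x s t * P (t, k) (s, l)) = (if s = x then P (x, k) (x, l) else 0)" for s
    proof -
      have "(\<Sum>t\<in>UNIV. ketbra x s t * P (t, k) (s, l)) =
        (\<Sum>t\<in>UNIV. if t = x then if s = x then P (x, k) (x, l) else 0 else 0)"
        by (intro sum.cong) (auto simp: ketbra_def)
      then show ?thesis by simp
    qed
    then show ?thesis by (simp add: slice_def)
  qed
  then have "slice P x = (\<lambda>k l. \<Sum>s\<in>UNIV. \<Sum>t\<in>UNIV. ketbra x s t * P (t, k) (s, l))"
    by (simp add: fun_eq_iff)
  then show ?thesis
    using psd_contract[of UNIV "ketbra x" UNIV P] assms by (simp add: psd_ketbra)
qed

lemma test_slice:
  fixes P :: "('x::finite \<times> 'b::finite) oper"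
  assumes "test P"
  shows "test (slice P x)"
proof -
  have "op_diff (id_op UNIV) (slice P x) = slice (op_diff (id_op UNIV) P) x"
    by (auto simp: op_diff_def slice_def id_op_def fun_eq_iff)
  then show ?thesis using assms by (simp add: test_def psd_slice)
qed

text \<open>Off-diagonal blocks of the state vanish, so a test acts only through its slices; these
  later serve as tests for single codewords.\<close>

lemma expval_cq_state:
  fixes P :: "('x::finite \<times> 'b::finite) oper"
  shows "expval P (cq_state p \<rho>) = wavg UNIV p (\<lambda>x. expval (slice P x) (\<rho> x))"
proof -
  have "op_trace UNIV (op_mult UNIV P (cq_state p \<rho>)) =
      (\<Sum>x\<in>UNIV. \<Sum>b\<in>UNIV. \<Sum>x'\<in>UNIV. if x' = x then \<Sum>b'\<in>UNIV. of_real (p x) * (P (x, b) (x, b') * \<rho> x b' b) else 0)"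
    unfolding op_trace_mult UNIV_Times_UNIV[symmetric] sum.cartesian_product'
    by (intro sum.cong refl) (auto simp: cq_state_apply intro!: sum.cong sum.neutral)
  also have "\<dots> = (\<Sum>x\<in>UNIV. of_real (p x) * op_trace UNIV (op_mult UNIV (slice P x) (\<rho> x)))"
    by (simp add: op_trace_mult slice_def sum_distrib_left)
  finally show ?thesis by (simp add: expval_def wavg_def)
qed

lemma psd_cq_state:
  fixes \<rho> :: "'x::finite \<Rightarrow> 'b::finite oper"
  assumes "\<And>x. p x \<ge> 0" "\<And>x. psd UNIV (\<rho> x)"
  shows "psd UNIV (cq_state p \<rho>)"
  unfolding cq_state_def UNIV_Times_UNIV[symmetric] using assms
  by (intro psd_sum psd_scale psd_tensor psd_ketbra) auto

lemma expval_cq_id: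
  fixes \<rho> :: "'x::finite \<Rightarrow> 'b::finite oper"
  assumes "\<And>x. state UNIV (\<rho> x)" "sum p UNIV = 1"
  shows "expval (id_op UNIV) (cq_state p \<rho>) = 1"
proof -
  have "slice (id_op UNIV) x = (id_op UNIV :: 'b oper)" for x :: 'x
    by (auto simp: slice_def id_op_def fun_eq_iff)
  then show ?thesis
    using assms wavg_const[OF assms(2)] by (simp add: expval_cq_state state_def expval_id)
qed

text \<open>Every number strictly below the supremum is exceeded by some test, and the slack
  \<open>\<kappa>\<close> makes the inequality strict. Bounding
  \<open>2 powr R * expval P \<sigma>\<close> treats an infinite entropy together with the finite
  case.\<close>

lemma near_optimal_test:
  fixes \<rho> \<sigma> :: "'i::finite oper"
  assumes \<rho>: "expval (id_op UNIV) \<rho> = 1" and \<sigma>: "psd UNIV \<sigma>" and \<epsilon>: "\<epsilon> \<ge> 0" and \<kappa>: "\<kappa> > 0"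
  obtains P where "test P" "expval P \<rho> \<ge> 1 - \<epsilon>"
    "2 powr R * expval P \<sigma> \<le> pow2 (ereal R - hyp_test_entropy \<epsilon> \<rho> \<sigma>) + \<kappa>"
proof -
  let ?D = "hyp_test_entropy \<epsilon> \<rho> \<sigma>"
  define X where "X = {P :: 'i oper. test P \<and> expval P \<rho> \<ge> 1 - \<epsilon>}"
  have D: "?D = (SUP P\<in>X. neg_log2 (expval P \<sigma>))"
    by (simp add: hyp_test_entropy_def X_def test_def expval_def)
  have "id_op UNIV \<in> X"
  proof -
    have "op_diff (id_op UNIV) (id_op UNIV) = ((\<lambda>_ _. 0) :: 'i oper)"
      by (simp add: op_diff_def fun_eq_iff)
    then show ?thesis using \<rho> \<epsilon> by (simp add: X_def test_def psd_id_op psd_zero)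
  qed
  then have "neg_log2 (expval (id_op UNIV) \<sigma>) \<le> ?D"
    unfolding D by (rule SUP_upper)
  moreover have "neg_log2 t \<noteq> - \<infinity>" for t by (simp add: neg_log2_def)
  ultimately have D_finite: "?D \<noteq> - \<infinity>" by auto
  \<comment> \<open>The number \<open>R - log 2 \<tau>\<close> is the exponent of a test that meets
    the target \<open>\<tau>\<close> exactly; \<open>\<kappa>\<close> keeps \<open>\<tau>\<close>
    positive when the entropy is infinite.\<close>
  define \<tau> where "\<tau> = pow2 (ereal R - ?D) + \<kappa>"
  have "\<tau> > 0 \<and> ereal (R - log 2 \<tau>) < ?D"
  proof (cases ?D)
    case (real d)
    have "\<tau> = 2 powr (R - d) + \<kappa>" by (simp add: \<tau>_def real pow2_def)
    then have "2 powr (R - d) < \<tau>" using \<kappa> by simp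
    moreover have "(0::real) < 2 powr (R - d)" by simp
    ultimately have "\<tau> > 0" "log 2 (2 powr (R - d)) < log 2 \<tau>"
      by (auto simp only: log_less_cancel_iff)
    then show ?thesis by (simp add: real)
  next
    case PInf
    then show ?thesis using \<kappa> by (simp add: \<tau>_def pow2_def)
  qed (use D_finite in simp)
  then have \<tau>: "\<tau> > 0" and less: "ereal (R - log 2 \<tau>) < ?D" by auto
  then obtain P where P: "P \<in> X" "ereal (R - log 2 \<tau>) < neg_log2 (expval P \<sigma>)"
    unfolding D less_SUP_iff by blast
  have "2 powr R * expval P \<sigma> \<le> \<tau>"
  proof (cases "expval P \<sigma> = 0")
    case False
    have "expval P \<sigma> \<ge> 0" using P(1) \<sigma> by (intro expval_nonneg) (auto simp: X_def test_def)
    then have pos: "expval P \<sigma> > 0" using False by simp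
    have "R + log 2 (expval P \<sigma>) < log 2 \<tau>"
      using P(2) False by (simp add: neg_log2_def)
    then have "log 2 (2 powr R * expval P \<sigma>) < log 2 \<tau>" using pos by (simp add: log_mult)
    then have "2 powr R * expval P \<sigma> < \<tau>"
      using pos \<tau> by (subst (asm) log_less_cancel_iff) auto
    then show ?thesis by simp
  qed (use \<tau> in simp)
  then show thesis using that P(1) unfolding X_def \<tau>_def by blast
qed

text \<open>The induction step is \<open>0 \<le> (1 - p) * (1 - s n)\<close> for the product
  \<open>p\<close> of the first \<open>n\<close> factors.\<close>

lemma one_minus_prod_le:
  fixes s :: "nat \<Rightarrow> real"
  assumes "\<And>j. j < n \<Longrightarrow> 0 \<le> s j" "\<And>j. j < n \<Longrightarrow> s j \<le> 1"
  shows "1 - (\<Prod>j<n. s j) \<le> (\<Sum>j<n. 1 - s j)"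
  using assms
proof (induction n)
  case (Suc n)
  have "(\<Prod>j<n. s j) \<le> 1" "0 \<le> (\<Prod>j<n. s j)"
    using Suc.prems by (auto intro!: prod_le_1 prod_nonneg)
  then have "0 \<le> (1 - (\<Prod>j<n. s j)) * (1 - s n)"
    using Suc.prems by (intro mult_nonneg_nonneg) auto
  then show ?case using Suc by (simp add: algebra_simps)
qed simp

section \<open>Marginals and joint tests\<close>

definition left_marginal :: "('i::finite \<times> 'k::finite) oper \<Rightarrow> 'i oper" where
  "left_marginal A = (\<lambda>i j. \<Sum>k\<in>UNIV. A (i, k) (j, k))"

definition right_marginal :: "('i::finite \<times> 'k::finite) oper \<Rightarrow> 'k oper" where
  "right_marginal A = (\<lambda>k l. \<Sum>i\<in>UNIV. A (i, k) (i, l))"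

lemma expval_left_marginal:
  "expval A (left_marginal \<sigma>) = expval (tensor A (id_op UNIV)) \<sigma>"
proof -
  have "op_trace UNIV (op_mult UNIV (tensor A (id_op UNIV)) \<sigma>) =
      (\<Sum>i\<in>UNIV. \<Sum>k\<in>UNIV. \<Sum>j\<in>UNIV. \<Sum>l\<in>UNIV. if l = k then A i j * \<sigma> (j, k) (i, k) else 0)"
    unfolding op_trace_mult UNIV_Times_UNIV[symmetric] sum.cartesian_product'
    by (intro sum.cong refl) (auto simp: tensor_def id_op_def)
  also have "\<dots> = (\<Sum>i\<in>UNIV. \<Sum>j\<in>UNIV. \<Sum>k\<in>UNIV. A i j * \<sigma> (j, k) (i, k))"
    by (simp, intro sum.cong refl sum.swap)
  finally show ?thesis
    by (simp add: expval_def op_trace_mult left_marginal_def sum_distrib_left)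
qed

lemma expval_right_marginal:
  "expval B (right_marginal \<sigma>) = expval (tensor (id_op UNIV) B) \<sigma>"
proof -
  have "op_trace UNIV (op_mult UNIV (tensor (id_op UNIV) B) \<sigma>) =
      (\<Sum>i\<in>UNIV. \<Sum>k\<in>UNIV. \<Sum>j\<in>UNIV. if j = i then \<Sum>l\<in>UNIV. B k l * \<sigma> (i, l) (i, k) else 0)"
    unfolding op_trace_mult UNIV_Times_UNIV[symmetric] sum.cartesian_product'
    by (intro sum.cong refl) (auto simp: tensor_def id_op_def)
  also have "\<dots> = (\<Sum>k\<in>UNIV. \<Sum>l\<in>UNIV. \<Sum>i\<in>UNIV. B k l * \<sigma> (i, l) (i, k))"
    by (simp, rule sum_pull2[symmetric])
  finally show ?thesis
    by (simp add: expval_def op_trace_mult right_marginal_def sum_distrib_left)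
qed

lemma state_right_marginal:
  assumes "state UNIV \<sigma>"
  shows "state UNIV (right_marginal \<sigma>)"
proof -
  have "right_marginal \<sigma> = (\<lambda>k l. \<Sum>s\<in>UNIV. \<Sum>t\<in>UNIV. id_op UNIV s t * \<sigma> (t, k) (s, l))"
    by (simp add: right_marginal_def id_op_def fun_eq_iff if_distrib[of "\<lambda>x. x * _"] cong: if_cong)
  then have "psd UNIV (right_marginal \<sigma>)"
    using psd_contract[of UNIV "id_op UNIV" UNIV \<sigma>] assms by (simp add: psd_id_op state_def)
  moreover have "op_trace UNIV (right_marginal \<sigma>) = op_trace UNIV \<sigma>"
    unfolding op_trace_def right_marginal_def UNIV_Times_UNIV[symmetric] sum.cartesian_product'
    by (rule sum.swap)
  ultimately show ?thesis using assms by (simp add: state_def)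
qed

lemma state_left_marginal:
  assumes "state UNIV \<sigma>"
  shows "state UNIV (left_marginal \<sigma>)"
proof -
  \<comment> \<open>Exchanging the two factors reduces the claim to the right marginal.\<close>
  define \<sigma>' where "\<sigma>' = (\<lambda>(k, i) (l, j). \<sigma> (i, k) (j, l))"
  have "qform UNIV \<sigma>' v = qform UNIV \<sigma> (\<lambda>(i, k). v (k, i))" for v
  proof -
    have "qform UNIV \<sigma>' v = (\<Sum>k\<in>UNIV. \<Sum>i\<in>UNIV. \<Sum>l\<in>UNIV. \<Sum>j\<in>UNIV. cnj (v (k, i)) * \<sigma> (i, k) (j, l) * v (l, j))"
      unfolding UNIV_Times_UNIV[symmetric] qform_Times by (simp add: \<sigma>'_def)
    also have "\<dots> = (\<Sum>i\<in>UNIV. \<Sum>k\<in>UNIV. \<Sum>l\<in>UNIV. \<Sum>j\<in>UNIV. cnj (v (k, i)) * \<sigma> (i, k) (j, l) * v (l, j))"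
      by (rule sum.swap)
    also have "\<dots> = (\<Sum>i\<in>UNIV. \<Sum>k\<in>UNIV. \<Sum>j\<in>UNIV. \<Sum>l\<in>UNIV. cnj (v (k, i)) * \<sigma> (i, k) (j, l) * v (l, j))"
      by (intro sum.cong refl sum.swap)
    also have "\<dots> = qform UNIV \<sigma> (\<lambda>(i, k). v (k, i))"
      unfolding UNIV_Times_UNIV[symmetric] qform_Times by simp
    finally show ?thesis .
  qed
  then have "psd UNIV \<sigma>'" using assms by (simp add: state_def psd_iff_qform operators_def)
  moreover have "op_trace UNIV \<sigma>' = op_trace UNIV \<sigma>"
    unfolding op_trace_def UNIV_Times_UNIV[symmetric] sum.cartesian_product'
    by (simp add: \<sigma>'_def) (rule sum.swap)
  ultimately have "state UNIV \<sigma>'" using assms by (simp add: state_def)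
  then have "state UNIV (right_marginal \<sigma>')" by (rule state_right_marginal)
  then show ?thesis by (simp add: right_marginal_def left_marginal_def \<sigma>'_def)
qed

text \<open>Expanding (1 - A) \<otimes> (1 - B) \<ge> 0 shows that the errors of relay and receiver
  in a block add up, even if their outputs are correlated or entangled.\<close>

lemma expval_tensor_union:
  assumes "test A" "test B" and \<sigma>: "state UNIV \<sigma>"
  shows "1 - expval (tensor A B) \<sigma> \<le>
    (1 - expval A (left_marginal \<sigma>)) + (1 - expval B (right_marginal \<sigma>))"
proof -
  let ?A = "op_diff (id_op UNIV) A" and ?B = "op_diff (id_op UNIV) B"
  have "psd UNIV (tensor ?A ?B)"
    using psd_tensor[of UNIV ?A UNIV ?B] assms by (simp add: test_def)
  then have "0 \<le> expval (tensor ?A ?B) \<sigma>" using \<sigma> by (simp add: expval_nonneg state_def)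
  also have "tensor ?A ?B = (\<lambda>u v. (id_op UNIV u v - tensor A (id_op UNIV) u v) -
      (tensor (id_op UNIV) B u v - tensor A B u v))"
    by (auto simp: fun_eq_iff tensor_def op_diff_def id_op_def algebra_simps)
  finally show ?thesis
    unfolding expval_linear expval_left_marginal expval_right_marginal
    using \<sigma> expval_id[of \<sigma>] by (simp add: state_def)
qed

text \<open>The complement 1 - A \<otimes> B splits as (1 - A) \<otimes> 1 + A \<otimes> (1 -
  B).\<close>

lemma expval_tensor_le_1:
  fixes A :: "'i::finite oper" and B :: "'k::finite oper"
  assumes "test A" "test B" and \<sigma>: "state UNIV \<sigma>"
  shows "expval (tensor A B) \<sigma> \<le> 1"
proof -
  let ?A = "op_diff (id_op UNIV) A" and ?B = "op_diff (id_op UNIV) B"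
  have "psd UNIV (tensor ?A (id_op (UNIV :: 'k set)))" "psd UNIV (tensor A ?B)"
    using psd_tensor[of UNIV ?A UNIV "id_op (UNIV :: 'k set)"] psd_tensor[of UNIV A UNIV ?B] assms
    by (simp_all add: test_def psd_id_op)
  then have "0 \<le> expval (tensor ?A (id_op UNIV)) \<sigma> + expval (tensor A ?B) \<sigma>"
    using \<sigma> by (simp add: expval_nonneg state_def)
  also have "\<dots> = expval (\<lambda>u v. tensor ?A (id_op UNIV) u v + tensor A ?B u v) \<sigma>"
    unfolding expval_linear ..
  also have "(\<lambda>u v. tensor ?A (id_op UNIV) u v + tensor A ?B u v) = (\<lambda>u v. id_op UNIV u v - tensor A B u v)"
    by (auto simp: fun_eq_iff tensor_def op_diff_def id_op_def algebra_simps)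
  finally show ?thesis
    unfolding expval_linear using \<sigma> expval_id[of \<sigma>] by (simp add: state_def)
qed

subsection \<open>Achievability\<close>

lemma ptensor_cong:
  assumes "\<And>j. j < n \<Longrightarrow> Q j = Q' j"
  shows "ptensor Q n = ptensor Q' n"
  using assms by (simp add: ptensor_def fun_eq_iff)

text \<open>The messages of the code are the tuples of inner block messages,
  \<open>K ^ (b - 1)\<close> in number, so fixing the boundary messages costs one block of rate. The
  hypothesis bounds the error of a single block under a uniform pair of messages, split into relay
  and receiver parts.\<close>

lemma achievable_block_code:
  fixes N :: "'x1::finite \<times> 'x2::finite \<Rightarrow> ('b2::finite \<times> 'b3::finite) oper"
  assumes N: "cq_relay_channel N" and b: "b \<ge> 1" and K: "K \<ge> 1" and R: "R \<ge> 0" "2 powr R \<le> real K"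
    and E: "\<And>k. k < K \<Longrightarrow> povm UNIV {..<K} (E k)" and Q: "povm UNIV {..<K} Q"
    and err: "(\<Sum>k<K. \<Sum>m<K. (1 - expval (E k m) (left_marginal (N (y k m, x k))))
        + (1 - expval (Q k) (right_marginal (N (y k m, x k))))) \<le> (real K)\<^sup>2 * \<eta>"
  shows "achievable N ((real b - 1) / real b * R) b (real b * \<eta>)"
proof -
  define e where "e k m = (1 - expval (E k m) (left_marginal (N (y k m, x k))))
        + (1 - expval (Q k) (right_marginal (N (y k m, x k))))" for k m
  let ?S = "PiE {1..<b} (\<lambda>_. {..<K})"
  obtain m0 mb where m: "m0 < K" "mb < K" and avg: "(\<Sum>f\<in>?S. \<Sum>j<b.
       e ((f(b := mb, 0 := m0)) j) ((f(b := mb, 0 := m0)) (Suc j)))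
      \<le> real K ^ (b - 1) * (real b * \<eta>)"
    using fix_boundary_messages[OF err[folded e_def] K b] by blast
  interpret relay_protocol N K m0 x E
    using N m(1) E by unfold_locales
  have fS: "finite ?S" by (intro finite_PiE) auto
  have cS: "card ?S = K ^ (b - 1)" by (simp add: card_PiE)
  \<comment> \<open>Messages of a code are natural numbers, so the tuples are enumerated.\<close>
  obtain h where h: "bij_betw h {..<card ?S} ?S"
    using ex_bij_betw_nat_finite[OF fS] atLeast0LessThan by metis
  define \<mu> where "\<mu> f = f(b := mb, 0 := m0)" for f :: "nat \<Rightarrow> nat"
  have \<mu>0: "\<mu> f 0 = m0" for f by (simp add: \<mu>_def)
  have \<mu>K: "\<mu> f j < K" if "f \<in> ?S" "j \<le> b" for f j
    using that m by (auto simp: \<mu>_def PiE_iff)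
  \<comment> \<open>At index 0 nothing is measured. Indices from \<open>b\<close> on lie outside the
    word; the identity there keeps \<open>Q' f j\<close> positive for all \<open>j\<close>, even
    where \<open>f\<close> is undefined.\<close>
  define Q' where "Q' f j = (if j = 0 \<or> b \<le> j then id_op UNIV else Q (f j))" for f :: "nat \<Rightarrow> nat" and j
  have ptQ': "ptensor (\<lambda>j. if j = 0 then id_op UNIV else Q (f j)) b = ptensor (Q' f) b" for f
    by (rule ptensor_cong) (simp add: Q'_def)
  \<comment> \<open>Positions count from 0: block \<open>j\<close> carries the old message
    \<open>\<mu> j\<close>, known to the relay, and the new message
    \<open>\<mu> (j + 1)\<close>.\<close>
  define C :: "('x1, 'x2, 'b2, 'b3) relay_code" where
    "C = \<lparr>messages = {..<card ?S}, enc = (\<lambda>i. map (\<lambda>j. y (\<mu> (h i) j) (\<mu> (h i) (Suc j))) [0..<b]),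
      mem_dim = (\<lambda>j. if j = 0 then 1 else K), relay_op = relay,
      decoder = (\<lambda>i. ptensor (Q' (h i)) b)\<rparr>"
  have C: "messages C = {..<card ?S}" "mem_dim C = (\<lambda>j. if j = 0 then 1 else K)" "relay_op C = relay"
     "decoder C = (\<lambda>i. ptensor (Q' (h i)) b)" and len: "length (enc C i) = b"
     and enc: "j < b \<Longrightarrow> enc C i ! j = y (\<mu> (h i) j) (\<mu> (h i) (Suc j))" for i j
    by (simp_all add: C_def)
  \<comment> \<open>This rate, \<open>(b - 1) / b\<close> times \<open>log 2 K\<close>, makes the
    number of messages exact.\<close>
  define R' where "R' = log 2 (real (K ^ (b - 1))) / real b"
  have Kb: "real (K ^ (b - 1)) > 0" using K by simp
  have pow: "2 powr (real b * R') = real (K ^ (b - 1))"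
    using b Kb by (simp add: R'_def del: of_nat_power)
  have "R \<le> log 2 (real K)" using R K by (simp add: le_log_iff)
  then have "(real b - 1) * R \<le> (real b - 1) * log 2 (real K)"
    using b by (intro mult_left_mono) auto
  then have R'_ge: "R' \<ge> (real b - 1) / real b * R"
    using b K by (simp add: R'_def log_nat_power of_nat_diff divide_right_mono)
  have povm: "povm {bs. length bs = b} (messages C) (decoder C)"
  proof -
    have P: "povm {bs. length bs = b} ?S (\<lambda>f. ptensor (Q' f) b)"
      using povm_ptensor[OF Q b] unfolding ptQ' .
    have "(\<Sum>i<card ?S. ptensor (Q' (h i)) b bs bs') = (\<Sum>f\<in>?S. ptensor (Q' f) b bs bs')" for bs bs'
      by (rule sum.reindex_bij_betw[OF h])
    moreover have "h i \<in> ?S" if "i < card ?S" for i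
      using h that by (auto simp: bij_betw_def)
    ultimately show ?thesis using P unfolding C povm_def by simp
  qed
  have valid: "valid_code b R' C"
    unfolding valid_code_def
  proof (intro conjI ballI)
    fix j assume "j \<in> {1..b}"
    then show "quantum_channel (relay_labels C (j - 1)) (UNIV \<times> {..<mem_dim C j}) (relay_op C j)"
      unfolding C(3) by (intro quantum_channel_relay(1)[OF C(2)]) simp
    show "\<forall>z z' k k'. z \<noteq> z' \<longrightarrow> relay_op C j A (z, k) (z', k') = 0" for A
      unfolding C(3) using quantum_channel_relay(2)[OF C(2)] \<open>j \<in> {1..b}\<close> by auto
  qed (use povm len pow cS C in auto)
  have psdQ: "psd UNIV (Q' f j)" if "f \<in> ?S" for f j
    using Q that by (auto simp: Q'_def povm_def psd_id_op PiE_iff)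
  have st: "state UNIV (N z)" for z using N unfolding cq_relay_channel_def by blast
  have tE: "test (E k m)" if "k < K" "m < K" for k m using povm_test[OF E] that by auto
  have tQ: "test (Q m)" if "m < K" for m using povm_test[OF Q] that by auto
  have tid: "test (id_op UNIV :: 'b3 oper)"
  proof -
    have "op_diff (id_op UNIV) (id_op UNIV) = ((\<lambda>_ _. 0) :: 'b3 oper)"
      by (simp add: op_diff_def fun_eq_iff)
    then show ?thesis by (simp add: test_def psd_id_op psd_zero)
  qed
  have err_i: "Re (op_trace {bs. length bs = b} (op_mult {bs. length bs = b}
      (op_diff (id_op {bs. length bs = b}) (decoder C i)) (receiver_state N C b i)))
      \<le> (\<Sum>j<b. e (\<mu> (h i) j) (\<mu> (h i) (Suc j)))" if i: "i < card ?S" for i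
  proof -
    let ?f = "h i"
    have f: "?f \<in> ?S" using h i by (auto simp: bij_betw_def)
    define s where "s j = Re (block_prob (Q' ?f j) (enc C i ! j) (\<mu> ?f j) (\<mu> ?f (Suc j)))" for j
    have s: "s j = expval (tensor (E (\<mu> ?f j) (\<mu> ?f (Suc j))) (Q' ?f j)) (N (enc C i ! j, x (\<mu> ?f j)))" for j
      by (simp add: s_def block_prob_def expval_def)
    have tQ': "test (Q' ?f j)" for j
      using tid tQ f by (auto simp: Q'_def PiE_iff)
    have s_bounds: "0 \<le> s j" "s j \<le> 1" "1 - s j \<le> e (\<mu> ?f j) (\<mu> ?f (Suc j))" if j: "j < b" for j
    proof -
      have K': "\<mu> ?f j < K" "\<mu> ?f (Suc j) < K" using \<mu>K[OF f] j by auto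
      show "0 \<le> s j"
        using block_prob_nonneg[OF psdQ[OF f] K'] by (simp add: s_def complex_nonneg_Reals_iff)
      show "s j \<le> 1" unfolding s by (intro expval_tensor_le_1 tE tQ' K' st)
      have "1 - s j \<le> (1 - expval (E (\<mu> ?f j) (\<mu> ?f (Suc j))) (left_marginal (N (enc C i ! j, x (\<mu> ?f j)))))
         + (1 - expval (Q' ?f j) (right_marginal (N (enc C i ! j, x (\<mu> ?f j)))))"
        unfolding s by (intro expval_tensor_union tE tQ' K' st)
      also have "\<dots> \<le> e (\<mu> ?f j) (\<mu> ?f (Suc j))"
      \<comment> \<open>At index 0 the identity accepts at least as often as \<open>Q\<close> would,
        so the bound for a regular block still holds.\<close>
      proof (cases "j = 0")
        case False
        then have "Q' ?f j = Q (\<mu> ?f j)" using j by (simp add: Q'_def \<mu>_def)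
        then show ?thesis unfolding e_def enc[OF j] by simp
      next
        case True
        let ?\<sigma> = "right_marginal (N (enc C i ! j, x (\<mu> ?f j)))"
        have st': "state UNIV ?\<sigma>" by (intro state_right_marginal st)
        have "0 \<le> expval (op_diff (id_op UNIV) (Q (\<mu> ?f j))) ?\<sigma>"
          using tQ[OF K'(1)] st' by (intro expval_nonneg) (auto simp: test_def state_def)
        then have "expval (Q (\<mu> ?f j)) ?\<sigma> \<le> expval (id_op UNIV) ?\<sigma>"
          by (simp add: op_diff_def expval_linear)
        moreover have "Q' ?f j = id_op UNIV" using True by (simp add: Q'_def)
        ultimately show ?thesis unfolding e_def enc[OF j] by simp
      qed
      finally show "1 - s j \<le> e (\<mu> ?f j) (\<mu> ?f (Suc j))" .
    qed
    have "Re (op_trace {bs. length bs = b} (op_mult {bs. length bs = b}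
      (op_diff (id_op {bs. length bs = b}) (decoder C i)) (receiver_state N C b i))) \<le> 1 - (\<Prod>j<b. s j)"
      unfolding C(4) s_def using \<mu>0 \<mu>K[OF f] psdQ[OF f]
      by (intro decoding_error_le C b) auto
    also have "\<dots> \<le> (\<Sum>j<b. 1 - s j)" using s_bounds by (intro one_minus_prod_le) auto
    also have "\<dots> \<le> (\<Sum>j<b. e (\<mu> ?f j) (\<mu> ?f (Suc j)))" using s_bounds by (intro sum_mono) auto
    finally show ?thesis .
  qed
  have "error_prob N b C \<le> (\<Sum>i<card ?S. \<Sum>j<b. e (\<mu> (h i) j) (\<mu> (h i) (Suc j))) / real (card ?S)"
    unfolding error_prob_def C(1) card_lessThan
    by (intro divide_right_mono sum_mono err_i) auto
  also have "(\<Sum>i<card ?S. \<Sum>j<b. e (\<mu> (h i) j) (\<mu> (h i) (Suc j))) = (\<Sum>f\<in>?S. \<Sum>j<b. e (\<mu> f j) (\<mu> f (Suc j)))"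
    by (rule sum.reindex_bij_betw[OF h])
  also have "\<dots> / real (card ?S) \<le> real K ^ (b - 1) * (real b * \<eta>) / real (card ?S)"
    using avg unfolding \<mu>_def by (intro divide_right_mono) auto
  also have "\<dots> = real b * \<eta>" using K unfolding cS by simp
  finally have "error_prob N b C \<le> real b * \<eta>" .
  then show ?thesis
    unfolding achievable_def using R'_ge valid by blast
qed

lemma achievable_mono:
  assumes "achievable N R n \<delta>" "\<delta> \<le> \<delta>'"
  shows "achievable N R n \<delta>'"
  using assms unfolding achievable_def by (meson order_trans)

text \<open>On (0, 1] the cube root of \<open>\<epsilon>\<close> is at least
  \<open>\<epsilon>\<close>, and the last summand of the coefficient alone is at least 16.\<close>

lemma univ_f_lower_bound:
  assumes "0 < \<epsilon>" "\<epsilon> \<le> 1" "k \<ge> 1"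
  shows "16 * \<epsilon> \<le> univ_f k \<epsilon>"
proof -
  have "\<epsilon> powr 1 \<le> \<epsilon> powr (1 / 3)" using assms by (intro powr_mono') auto
  then have 1: "\<epsilon> \<le> \<epsilon> powr (1 / 3)" using assms by simp
  define u where "u = (2::real) ^ (2 ^ (k + 5) + k\<^sup>2 + 2 * k)"
  define v where "v = (2::real) powr ((real k + 1) / 2)"
  have "(2::real) ^ 2 \<le> u"
    unfolding u_def using assms(3) by (intro power_increasing) auto
  moreover have "0 \<le> v" by (simp add: v_def)
  ultimately have "16 \<le> 1 + 6 * v + 4 * u" by simp
  then show ?thesis
    unfolding univ_f_def u_def[symmetric] v_def[symmetric] using 1 assms(1) by (intro mult_mono) auto
qed

theorem proposition6:
  fixes N :: "'x1::finite \<times> 'x2::finite \<Rightarrow> ('b2::finite \<times> 'b3::finite) oper"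
    and p :: "('x1 \<times> 'x2) pmf"
    and \<rho> :: "(('x1 \<times> 'x2) \<times> ('b2 \<times> 'b3)) oper"
    and R \<epsilon> \<delta> :: real and b :: nat
  assumes "cq_relay_channel N"
    and "\<rho> = cq_state (pmf p) N"
    and "R \<ge> 0" and "0 < \<epsilon>" and "\<epsilon> < 1" and "b \<ge> 1"
    and "\<delta> = real b *
      (univ_f 1 \<epsilon> + univ_f 2 \<epsilon>
       + 4 * pow2 (ereal R - hyp_test_entropy \<epsilon> (reduce_X2B3 \<rho>)
                               (cond_product_state (\<lambda>_. ()) (reduce_X2B3 \<rho>)))
       + 4 * pow2 (ereal R - hyp_test_entropy \<epsilon> (reduce_X1X2B2 \<rho>)
                               (cond_product_state snd (reduce_X1X2B2 \<rho>))))"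
    and "0 \<le> \<delta>" and "\<delta> \<le> 1"
  shows "achievable N ((real b - 1) / real b * R) b \<delta>"
proof -

  \<comment> \<open>Superposition form of the input distribution\<close>
  have st: "state UNIV (N z)" for z using assms(1) unfolding cq_relay_channel_def by blast
  define q where "q s = (\<Sum>t\<in>UNIV. pmf p (t, s))" for s
  \<comment> \<open>This is the law of X1 given X2 = s. Where \<open>q s = 0\<close>, a point mass
    is the default, so that \<open>c s\<close> is a distribution for every \<open>s\<close>.\<close>
  define c where "c s t = (if q s = 0 then if t = undefined then 1 else 0 else pmf p (t, s) / q s)" for s t
  have q0: "q s \<ge> 0" for s by (simp add: q_def sum_nonneg)
  have pmf_total: "(\<Sum>z\<in>UNIV. pmf p z) = 1" by (rule sum_pmf_eq_1) auto
  have q1: "sum q UNIV = 1"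
  proof -
    have "sum q UNIV = (\<Sum>t\<in>UNIV. \<Sum>s\<in>UNIV. pmf p (t, s))" unfolding q_def by (rule sum.swap)
    also have "\<dots> = (\<Sum>z\<in>UNIV \<times> UNIV. pmf p z)" by (simp only: sum.cartesian_product')
    finally show ?thesis using pmf_total by simp
  qed
  have c0: "c s t \<ge> 0" for s t using q0 by (simp add: c_def)
  have c1: "sum (c s) UNIV = 1" for s
  proof (cases "q s = 0")
    case False
    then show ?thesis by (simp add: c_def q_def flip: sum_divide_distrib)
  qed (simp add: c_def)
  have qc: "q s * c s t = pmf p (t, s)" for s t
  proof (cases "q s = 0")
    case True
    then have "pmf p (t, s) = 0" unfolding q_def by (subst (asm) sum_nonneg_eq_0_iff) auto
    then show ?thesis using True by simp
  qed (simp add: c_def)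
  have wavg_p: "wavg UNIV (pmf p) g = wavg UNIV q (\<lambda>s. wavg UNIV (c s) (\<lambda>t. g (t, s)))" for g
  proof -
    have "wavg UNIV (pmf p) g = (\<Sum>t\<in>UNIV. \<Sum>s\<in>UNIV. pmf p (t, s) * g (t, s))"
      unfolding wavg_def UNIV_Times_UNIV[symmetric] sum.cartesian_product' ..
    also have "\<dots> = (\<Sum>s\<in>UNIV. \<Sum>t\<in>UNIV. pmf p (t, s) * g (t, s))" by (rule sum.swap)
    finally show ?thesis by (simp add: wavg_def sum_distrib_left qc[symmetric] mult.assoc)
  qed

  \<comment> \<open>Reduced states and conditional product states\<close>
  let ?N2 = "\<lambda>z. left_marginal (N z)" and ?N3 = "\<lambda>z. right_marginal (N z)"
  let ?\<rho>3 = "\<lambda>s \<beta> \<beta>'. \<Sum>t\<in>UNIV. of_real (c s t) * ?N3 (t, s) \<beta> \<beta>'"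
  have st3: "state UNIV (?\<rho>3 s)" for s
    using c0 c1 by (intro state_mixture state_right_marginal st) auto
  have st2: "state UNIV (?N2 z)" for z by (intro state_left_marginal st)

  have X2B3: "reduce_X2B3 \<rho> = cq_state q ?\<rho>3"
  proof (intro ext)
    fix u v :: "'x2 \<times> 'b3"
    obtain s \<beta> s' \<beta>' where uv: "u = (s, \<beta>)" "v = (s', \<beta>')" by fastforce
    show "reduce_X2B3 \<rho> u v = cq_state q ?\<rho>3 u v"
      unfolding uv assms(2)
      by (simp add: reduce_X2B3_def cq_state_apply right_marginal_def sum_distrib_left
          mult.assoc[symmetric] qc[symmetric])
  qed
  \<comment> \<open>A constant map has a single fibre, so the conditional average becomes the full
    average over \<open>q\<close>, which is the state of B3 alone.\<close>
  have cond3: "cond_product_state (\<lambda>_. ()) (reduce_X2B3 \<rho>) =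
      cq_state q (\<lambda>_ \<beta> \<beta>'. \<Sum>s\<in>UNIV. of_real (q s) * ?\<rho>3 s \<beta> \<beta>')"
    unfolding X2B3 cond_product_state_cq_state[OF st3] by (simp add: q1)
  have X1X2B2: "reduce_X1X2B2 \<rho> = cq_state (pmf p) ?N2"
  proof (intro ext)
    fix u v :: "('x1 \<times> 'x2) \<times> 'b2"
    obtain z \<beta> z' \<beta>' where uv: "u = (z, \<beta>)" "v = (z', \<beta>')" by fastforce
    show "reduce_X1X2B2 \<rho> u v = cq_state (pmf p) ?N2 u v"
      unfolding uv assms(2)
      by (simp add: reduce_X1X2B2_def cq_state_apply left_marginal_def sum_distrib_left)
  qed
  have fibre: "(\<Sum>z | snd z = s. g z) = (\<Sum>t\<in>UNIV. g (t, s))" for s and g :: "'x1 \<times> 'x2 \<Rightarrow> 'c::comm_monoid_add"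
  proof -
    have "{z. snd z = s} = (\<lambda>t. (t, s)) ` (UNIV :: 'x1 set)" by auto
    then show ?thesis by (simp add: sum.reindex inj_on_def)
  qed
  have cond2: "cond_product_state snd (reduce_X1X2B2 \<rho>) =
      cq_state (pmf p) (\<lambda>z \<beta> \<beta>'. \<Sum>t\<in>UNIV. of_real (c (snd z) t) * ?N2 (t, snd z) \<beta> \<beta>')"
  proof -
    \<comment> \<open>The quotient and \<open>c\<close> can differ only where \<open>q\<close>
      vanishes, and there the state has weight 0.\<close>
    have *: "pmf p z = 0 \<or> pmf p (t, snd z) / q (snd z) = c (snd z) t" for z t
      using qc[of "snd z" "fst z"] by (auto simp: c_def)
    have cong: "cq_state (pmf p) f = cq_state (pmf p) g" if "\<And>z. pmf p z = 0 \<or> f z = g z" for f g :: "_ \<Rightarrow> 'b2 oper"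
    proof -
      have "of_real (pmf p z) * f z \<beta> \<beta>' = of_real (pmf p z) * g z \<beta> \<beta>'" for z \<beta> \<beta>'
        using that[of z] by auto
      then show ?thesis by (auto simp: fun_eq_iff cq_state_apply)
    qed
    show ?thesis
      unfolding X1X2B2 cond_product_state_cq_state[OF st2] fibre q_def[symmetric]
    proof (rule cong)
      fix z
      show "pmf p z = 0 \<or> (\<lambda>\<beta> \<beta>'. \<Sum>t\<in>UNIV. of_real (pmf p (t, snd z) / q (snd z)) * ?N2 (t, snd z) \<beta> \<beta>') =
          (\<lambda>\<beta> \<beta>'. \<Sum>t\<in>UNIV. of_real (c (snd z) t) * ?N2 (t, snd z) \<beta> \<beta>')"
      proof (cases "pmf p z = 0")
        case False
        then have "pmf p (t, snd z) / q (snd z) = c (snd z) t" for t using *[of z t] by blast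
        then show ?thesis by (simp only:) simp
      qed simp
    qed
  qed

  \<comment> \<open>Near-optimal tests and their averages over the code ensemble\<close>
  have psd3: "psd UNIV (cond_product_state (\<lambda>_. ()) (reduce_X2B3 \<rho>))"
    unfolding cond3 using state_mixture[of UNIV ?\<rho>3 q] st3 q0 q1
    by (intro psd_cq_state) (simp_all add: state_def)
  have psd2: "psd UNIV (cond_product_state snd (reduce_X1X2B2 \<rho>))"
    unfolding cond2
  proof (rule psd_cq_state)
    show "psd UNIV (\<lambda>\<beta> \<beta>'. \<Sum>t\<in>UNIV. of_real (c (snd z) t) * ?N2 (t, snd z) \<beta> \<beta>')" for z
      using state_mixture[of UNIV "\<lambda>t. ?N2 (t, snd z)" "c (snd z)"] st2 c0 c1 by (simp add: state_def)
  qed simp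
  have id3: "expval (id_op UNIV) (reduce_X2B3 \<rho>) = 1"
    unfolding X2B3 by (intro expval_cq_id st3 q1)
  have id2: "expval (id_op UNIV) (reduce_X1X2B2 \<rho>) = 1"
    unfolding X1X2B2 by (intro expval_cq_id st2 pmf_total)
  \<comment> \<open>The slack is taken to be \<open>\<epsilon>\<close> itself, so that the multiples
    of \<open>\<epsilon>\<close> in \<open>univ_f\<close> can absorb it.\<close>
  obtain P3 where P3: "test P3" "expval P3 (reduce_X2B3 \<rho>) \<ge> 1 - \<epsilon>"
    "2 powr R * expval P3 (cond_product_state (\<lambda>_. ()) (reduce_X2B3 \<rho>)) \<le>
      pow2 (ereal R - hyp_test_entropy \<epsilon> (reduce_X2B3 \<rho>) (cond_product_state (\<lambda>_. ()) (reduce_X2B3 \<rho>))) + \<epsilon>"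
    using near_optimal_test[OF id3 psd3 less_imp_le[OF assms(4)] assms(4)] by blast
  obtain P2 where P2: "test P2" "expval P2 (reduce_X1X2B2 \<rho>) \<ge> 1 - \<epsilon>"
    "2 powr R * expval P2 (cond_product_state snd (reduce_X1X2B2 \<rho>)) \<le>
      pow2 (ereal R - hyp_test_entropy \<epsilon> (reduce_X1X2B2 \<rho>) (cond_product_state snd (reduce_X1X2B2 \<rho>))) + \<epsilon>"
    using near_optimal_test[OF id2 psd2 less_imp_le[OF assms(4)] assms(4)] by blast
  \<comment> \<open>In \<open>\<alpha> r s t\<close> the centre \<open>r\<close> is tested while the
    pair (\<open>t\<close>, \<open>s\<close>) is sent; in \<open>\<beta> s r t\<close> the satellite
    \<open>r\<close> is tested, with known centre \<open>s\<close>, while \<open>t\<close> is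
    sent.\<close>
  define \<alpha> where "\<alpha> r s t = expval (slice P3 r) (?N3 (t, s))" for r s t
  define \<beta> where "\<beta> s r t = expval (slice P2 (r, s)) (?N2 (t, s))" for s r t
  have A1: "expval P3 (reduce_X2B3 \<rho>) = wavg UNIV q (\<lambda>s. wavg UNIV (c s) (\<alpha> s s))"
    unfolding X2B3 expval_cq_state expval_mixture \<alpha>_def ..
  have A2: "expval P3 (cond_product_state (\<lambda>_. ()) (reduce_X2B3 \<rho>)) =
      wavg UNIV q (\<lambda>r. wavg UNIV q (\<lambda>s. wavg UNIV (c s) (\<alpha> r s)))"
    unfolding cond3 expval_cq_state expval_mixture \<alpha>_def ..
  have B1: "expval P2 (reduce_X1X2B2 \<rho>) = wavg UNIV q (\<lambda>s. wavg UNIV (c s) (\<lambda>t. \<beta> s t t))"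
    unfolding X1X2B2 expval_cq_state wavg_p \<beta>_def ..
  have B2: "expval P2 (cond_product_state snd (reduce_X1X2B2 \<rho>)) =
      wavg UNIV q (\<lambda>s. wavg UNIV (c s) (\<lambda>r. wavg UNIV (c s) (\<beta> s r)))"
    unfolding cond2 expval_cq_state wavg_p expval_mixture \<beta>_def snd_conv ..

  \<comment> \<open>Codebook, decoders and error estimate\<close>
  define K where "K = nat \<lceil>2 powr R\<rceil>"
  have "2 powr R \<ge> 1" using assms(3) by (simp add: ge_one_powr_ge_zero)
  \<comment> \<open>Only the number \<open>K - 1\<close> of wrong candidates enters the error, and
    it is at most \<open>2 powr R\<close>, so rounding up costs no factor.\<close>
  then have K: "K \<ge> 1" "2 powr R \<le> real K" "real K - 1 \<le> 2 powr R"
    unfolding K_def by linarith+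
  obtain x y where code: "(\<Sum>k<K. \<Sum>m<K.
        4 * (1 - \<alpha> (x k) (x k) (y k m)) + 4 * (\<Sum>l\<in>{..<K}-{k}. \<alpha> (x l) (x k) (y k m)) +
        (4 * (1 - \<beta> (x k) (y k m) (y k m)) + 4 * (\<Sum>l\<in>{..<K}-{m}. \<beta> (x k) (y k l) (y k m))))
     \<le> (real K)\<^sup>2 *
       (4 * (1 - wavg UNIV q (\<lambda>s. wavg UNIV (c s) (\<alpha> s s))) +
        4 * (real K - 1) * wavg UNIV q (\<lambda>r. wavg UNIV q (\<lambda>s. wavg UNIV (c s) (\<alpha> r s))) +
        (4 * (1 - wavg UNIV q (\<lambda>s. wavg UNIV (c s) (\<lambda>t. \<beta> s t t))) +
         4 * (real K - 1) * wavg UNIV q (\<lambda>s. wavg UNIV (c s) (\<lambda>r. wavg UNIV (c s) (\<beta> s r)))))"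
    (is "?code \<le> (real K)\<^sup>2 * ?\<eta>")
    using superposition_codebook[of q c K \<alpha> \<beta>, OF q0 q1 c0 c1 K(1)] by blast
  obtain Q where Q: "povm UNIV {..<K} Q"
    "\<And>m \<sigma>. m < K \<Longrightarrow> state UNIV \<sigma> \<Longrightarrow> 1 - expval (Q m) \<sigma> \<le>
       4 * (1 - expval (slice P3 (x m)) \<sigma>) + 4 * (\<Sum>l\<in>{..<K}-{m}. expval (slice P3 (x l)) \<sigma>)"
    using sequential_decoder_state[of K "\<lambda>m. slice P3 (x m)"] K(1) test_slice[OF P3(1)] by blast
  \<comment> \<open>The relay's decoder for estimate \<open>k\<close> tests the satellites of cloud
    \<open>k\<close> against each other.\<close>
  have "\<exists>E. povm UNIV {..<K} E \<and> (\<forall>m \<sigma>. m < K \<longrightarrow> state UNIV \<sigma> \<longrightarrow> 1 - expval (E m) \<sigma> \<le>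
       4 * (1 - expval (slice P2 (y k m, x k)) \<sigma>) + 4 * (\<Sum>l\<in>{..<K}-{m}. expval (slice P2 (y k l, x k)) \<sigma>))" for k
    using sequential_decoder_state[of K "\<lambda>m. slice P2 (y k m, x k)"] K(1) test_slice[OF P2(1)] by metis
  then obtain E where E: "\<And>k. povm UNIV {..<K} (E k)"
    "\<And>k m \<sigma>. m < K \<Longrightarrow> state UNIV \<sigma> \<Longrightarrow> 1 - expval (E k m) \<sigma> \<le>
       4 * (1 - expval (slice P2 (y k m, x k)) \<sigma>) + 4 * (\<Sum>l\<in>{..<K}-{m}. expval (slice P2 (y k l, x k)) \<sigma>)"
    by metis
  have "(\<Sum>k<K. \<Sum>m<K. (1 - expval (E k m) (?N2 (y k m, x k))) + (1 - expval (Q k) (?N3 (y k m, x k)))) \<le> ?code"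
  proof (intro sum_mono)
    fix k m assume km: "k \<in> {..<K}" "m \<in> {..<K}"
    show "(1 - expval (E k m) (?N2 (y k m, x k))) + (1 - expval (Q k) (?N3 (y k m, x k))) \<le>
        4 * (1 - \<alpha> (x k) (x k) (y k m)) + 4 * (\<Sum>l\<in>{..<K}-{k}. \<alpha> (x l) (x k) (y k m)) +
        (4 * (1 - \<beta> (x k) (y k m) (y k m)) + 4 * (\<Sum>l\<in>{..<K}-{m}. \<beta> (x k) (y k l) (y k m)))"
      unfolding \<alpha>_def \<beta>_def
      using Q(2)[of k "?N3 (y k m, x k)"] E(2)[of m "?N2 (y k m, x k)" k] km
        state_right_marginal[OF st] st2 by fastforce
  qed
  also note code
  finally have ach: "achievable N ((real b - 1) / real b * R) b (real b * ?\<eta>)"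
    by (intro achievable_block_code[OF assms(1,6) K(1) assms(3) K(2) E(1) Q(1)])
  have nn: "0 \<le> expval P3 (cond_product_state (\<lambda>_. ()) (reduce_X2B3 \<rho>))"
       "0 \<le> expval P2 (cond_product_state snd (reduce_X1X2B2 \<rho>))"
    using P2(1) P3(1) psd2 psd3 by (auto simp: test_def intro!: expval_nonneg)
  have "(real K - 1) * expval P3 (cond_product_state (\<lambda>_. ()) (reduce_X2B3 \<rho>)) \<le>
      2 powr R * expval P3 (cond_product_state (\<lambda>_. ()) (reduce_X2B3 \<rho>))"
    "(real K - 1) * expval P2 (cond_product_state snd (reduce_X1X2B2 \<rho>)) \<le>
      2 powr R * expval P2 (cond_product_state snd (reduce_X1X2B2 \<rho>))"
    using K(3) nn by (intro mult_right_mono; simp)+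
  \<comment> \<open>Each decoder costs 4 \<epsilon> for rejecting the sent candidate and 4
    \<epsilon> for the slack of its test. The total of 16 \<epsilon> is dominated by the two values
    of \<open>univ_f\<close>.\<close>
  then have "?\<eta> \<le> univ_f 1 \<epsilon> + univ_f 2 \<epsilon>
       + 4 * pow2 (ereal R - hyp_test_entropy \<epsilon> (reduce_X2B3 \<rho>)
                               (cond_product_state (\<lambda>_. ()) (reduce_X2B3 \<rho>)))
       + 4 * pow2 (ereal R - hyp_test_entropy \<epsilon> (reduce_X1X2B2 \<rho>)
                               (cond_product_state snd (reduce_X1X2B2 \<rho>)))"
    unfolding A1[symmetric] A2[symmetric] B1[symmetric] B2[symmetric] mult.assoc
    using P3(2,3) P2(2,3) univ_f_lower_bound[of \<epsilon> 1] univ_f_lower_bound[of \<epsilon> 2] assms(4,5)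
    by simp
  then have "real b * ?\<eta> \<le> \<delta>"
    unfolding assms(7) by (intro mult_left_mono) auto
  then show ?thesis using ach by (rule achievable_mono[rotated])
qed

end
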